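(* Let $m,n,r$ be positive integers. (Asymmetric) Let $M\in\mathbb{R}^{m\times n}$ with $\sigma_r(M)>0$. Then the function $\widetilde g_{\mathrm a}:\mathbb{R}^{m\times n}\to\overline{\mathbb{R}}$, $\widetilde g_{\mathrm a}(A):=\|A-M\|_F^2+\delta_{\mathbb{R}^{m\times n}_{\le r}}(A)$, has Kurdyka-Łojasiewicz exponent $1/2$ at any global minimum. Moreover, the function $f_{\mathrm a}:\mathbb{R}^{m\times r}\times\mathbb{R}^{r\times n}\to\mathbb{R}$, $f_{\mathrm a}(X,Y):=\|XY-M\|_F^2$, has Kurdyka-Łojasiewicz exponent $1/2$ at any global minimum. (Symmetric) Let $M\in\mathbb{S}^n_+$ with $\lambda_r(M)>0$. Then the function $\widetilde g_{\mathrm s}:\mathbb{S}^n\to\overline{\mathbb{R}}$, $\widetilde g_{\mathrm s}(A):=\|A-M\|_F^2+\delta_{\mathbb{S}^n_{\le r}}(A)$, has Kurdyka-Łojasiewicz exponent $1/2$ at any global minimum. Moreover, the function $f_{\mathrm s}:\mathbb{R}^{n\times r}\to\mathbb{R}$, $f_{\mathrm s}(X):=\|XX^\top-M\|_F^2$, has Kurdyka-Łojasiewicz exponent $1/2$ at any global minimum.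
   Context: $\overline{\mathbb{R}}:=\mathbb{R}\cup\{\infty\}$. $\sigma_i(M)$ is the $i$-th largest singular value and $\lambda_i(M)$ the $i$-th largest eigenvalue. $\mathbb{R}^{m\times n}_{\le r}$ is the set of $m\times n$ real matrices of rank at most $r$; $\mathbb{S}^n$ the symmetric $n\times n$ real matrices, $\mathbb{S}^n_+$ the positive semidefinite ones, $\mathbb{S}^n_{\le r}$ the symmetric ones of rank at most $r$. Matrix spaces carry the Frobenius inner product $\langle A,B\rangle=\operatorname{tr}(A^\top B)$ and norm $\|\cdot\|_F$. $\delta_C$ is the indicator function of $C$ ($0$ on $C$, $\infty$ elsewhere). For a function $f$ from a Euclidean space $E$ to $\overline{\mathbb{R}}$ and $\overline{x}\in\operatorname{dom} f:=\{f<\infty\}$: $\widehat\partial f(\overline{x}):=\{v: f(x)\ge f(\overline{x})+\langle v,x-\overline{x}\rangle+o(|x-\overline{x}|)\text{ near }\overline{x}\}$; $\partial f(\overline{x})$ is the set of $v$ for which there are $x_k$ and $v_k\in\widehat\partial f(x_k)$ with $(x_k,f(x_k),v_k)\to(\overline{x},f(\overline{x}),v)$; $\partial^\infty f(\overline{x})$ is the set of $v$ for which there are $x_k$, $v_k\in\widehat\partial f(x_k)$ and $\tau_k\downarrow 0$ with $(x_k,f(x_k),\tau_kv_k)\to(\overline{x},f(\overline{x}),v)$; the Clarke subdifferential is $\overline\partial f(\overline{x}):=\overline{\mathrm{co}}[\partial f(\overline{x})+\partial^\infty f(\overline{x})]$. $f$ has Kurdyka-Łojasiewicz exponent $\alpha\in[0,1)$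 at $\overline{x}\in\operatorname{dom} f$ if there exist $\rho,\ell,c>0$ such that $d(0,\overline\partial f(x))\ge c(f(x)-f(\overline{x}))^\alpha$ for all $x$ in the ball $B_\rho(\overline{x})$ with $0<f(x)-f(\overline{x})<\ell$, where $d(0,S)=\inf_{v\in S}|v|$ and $\inf\emptyset=\infty$. *)

theory Defs
  imports
    "HOL-Analysis.Analysis"
    "HOL-Library.Multiset"
    "HOL-Library.Landau_Symbols"
    "HOL-Library.Set_Algebras"
begin

text \<open>
  An \<open>m \<times> n\<close> real matrix is an element of \<open>real ^ 'n ^ 'm\<close>, with \<open>m = CARD('m)\<close> and
  \<open>n = CARD('n)\<close>. The inner product and norm of this type are the Frobenius ones:
\<close>

lemma inner_matrix_eq_trace:
  fixes A B :: "real ^ 'n ^ 'm"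
  shows "A \<bullet> B = trace (transpose A ** B)"
  unfolding trace_def transpose_def matrix_matrix_mult_def inner_vec_def
  by (simp, rule sum.swap)

subsection \<open>Eigenvalues and singular values\<close>

definition eigenspace :: "real ^ 'n ^ 'n \<Rightarrow> real \<Rightarrow> (real ^ 'n) set" where
  "eigenspace A t = {x. A *v x = t *\<^sub>R x}"

definition eigenvalues :: "real ^ 'n ^ 'n \<Rightarrow> real set" where
  "eigenvalues A = {t. \<exists>x\<in>eigenspace A t. x \<noteq> 0}"

text \<open>
  The eigenvalues of a symmetric matrix in decreasing order, each repeated according to its
  multiplicity. Geometric and algebraic multiplicity agree for symmetric matrices, the only
  ones to which this is applied.
\<close>

definition eigvals_desc :: "real ^ 'n ^ 'n \<Rightarrow> real list" where
  "eigvals_desc A = rev (sorted_list_of_multiset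
     (\<Sum>t\<in>eigenvalues A. replicate_mset (dim (eigenspace A t)) t))"

text \<open>The sum above is never over an infinite set:\<close>

lemma finite_eigenvalues:
  fixes A :: "real ^ 'n ^ 'n"
  assumes "transpose A = A"
  shows "finite (eigenvalues A)"
proof -
  have "\<exists>x. \<forall>t\<in>eigenvalues A. x t \<in> eigenspace A t \<and> x t \<noteq> 0"
    unfolding eigenvalues_def by (intro bchoice) auto
  then obtain x where x: "\<And>t. t \<in> eigenvalues A \<Longrightarrow> A *v x t = t *\<^sub>R x t"
    and nz: "\<And>t. t \<in> eigenvalues A \<Longrightarrow> x t \<noteq> 0"
    by (auto simp: eigenspace_def)
  have orth: "x s \<bullet> x t = 0" if "s \<in> eigenvalues A" "t \<in> eigenvalues A" "s \<noteq> t" for s t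
  proof -
    have "(A *v x s) \<bullet> x t = x s \<bullet> (A *v x t)"
      by (metis assms dot_lmul_matrix vector_transpose_matrix)
    then have "s * (x s \<bullet> x t) = t * (x s \<bullet> x t)"
      using x that by simp
    then show ?thesis using that by simp
  qed
  have "pairwise orthogonal (x ` eigenvalues A)"
    unfolding pairwise_def orthogonal_def using orth by auto
  moreover have "0 \<notin> x ` eigenvalues A" using nz by auto
  ultimately have "finite (x ` eigenvalues A)"
    using pairwise_orthogonal_independent independent_imp_finite by blast
  moreover have "inj_on x (eigenvalues A)"
    by (rule inj_onI) (metis orth nz inner_eq_zero_iff)
  ultimately show ?thesis by (rule finite_imageD)
qed

text \<open>
  Both enumerations are 1-based. Out of range they take the value \<open>0\<close>, so that a positive
  value at index \<open>r\<close> entails that \<open>r\<close> is in range.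
\<close>

definition eigval :: "real ^ 'n ^ 'n \<Rightarrow> nat \<Rightarrow> real" where
  "eigval A i = (if 1 \<le> i \<and> i \<le> length (eigvals_desc A) then eigvals_desc A ! (i - 1) else 0)"

definition singval :: "real ^ 'n ^ 'm \<Rightarrow> nat \<Rightarrow> real" where
  "singval A i = sqrt (eigval (transpose A ** A) i)"

subsection \<open>Matrix sets\<close>

definition sym_matrices :: "(real ^ 'n ^ 'n) set" where
  "sym_matrices = {A. transpose A = A}"

definition psd_matrices :: "(real ^ 'n ^ 'n) set" where
  "psd_matrices = {A \<in> sym_matrices. \<forall>x. 0 \<le> x \<bullet> (A *v x)}"

definition rank_le_matrices :: "nat \<Rightarrow> (real ^ 'n ^ 'm) set" where
  "rank_le_matrices r = {A. rank A \<le> r}"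

definition indicator_fun :: "'a set \<Rightarrow> 'a \<Rightarrow> ereal" where
  "indicator_fun C x = (if x \<in> C then 0 else \<infinity>)"

subsection \<open>Subdifferentials and the Kurdyka-Lojasiewicz exponent\<close>

text \<open>
  The Euclidean space on which a function lives is a linear subspace \<open>E\<close> of a type of class
  \<open>euclidean_space\<close>, with the inherited inner product: \<open>UNIV\<close>, or \<open>sym_matrices\<close> for the
  space of symmetric matrices. Points and subgradients are confined to \<open>E\<close>, and values of \<open>f\<close>
  outside \<open>E\<close> are irrelevant. Functions are intended not to take the value \<open>-\<infinity>\<close>.
\<close>

definition edom :: "'a set \<Rightarrow> ('a \<Rightarrow> ereal) \<Rightarrow> 'a set" where
  "edom E f = {x \<in> E. f x < \<infinity>}"

definition regular_subdiff ::
  "'a::euclidean_space set \<Rightarrow> ('a \<Rightarrow> ereal) \<Rightarrow> 'a \<Rightarrow> 'a set" where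
  "regular_subdiff E f x = {v \<in> E. x \<in> edom E f \<and>
     (\<exists>h :: 'a \<Rightarrow> real. h \<in> o[at x within E](\<lambda>y. norm (y - x)) \<and>
        (\<forall>\<^sub>F y in at x within E. f y \<ge> f x + ereal (v \<bullet> (y - x) + h y)))}"

definition limiting_subdiff ::
  "'a::euclidean_space set \<Rightarrow> ('a \<Rightarrow> ereal) \<Rightarrow> 'a \<Rightarrow> 'a set" where
  "limiting_subdiff E f x = {v. x \<in> edom E f \<and>
     (\<exists>xs vs. (\<forall>k::nat. vs k \<in> regular_subdiff E f (xs k)) \<and>
        xs \<longlonglongrightarrow> x \<and> (\<lambda>k. f (xs k)) \<longlonglongrightarrow> f x \<and> vs \<longlonglongrightarrow> v)}"

definition horizon_subdiff ::
  "'a::euclidean_space set \<Rightarrow> ('a \<Rightarrow> ereal) \<Rightarrow> 'a \<Rightarrow> 'a set" where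
  "horizon_subdiff E f x = {v. x \<in> edom E f \<and>
     (\<exists>xs vs (\<tau> :: nat \<Rightarrow> real). (\<forall>k. vs k \<in> regular_subdiff E f (xs k)) \<and>
        (\<forall>k. 0 < \<tau> k) \<and> decseq \<tau> \<and> \<tau> \<longlonglongrightarrow> 0 \<and>
        xs \<longlonglongrightarrow> x \<and> (\<lambda>k. f (xs k)) \<longlonglongrightarrow> f x \<and> (\<lambda>k. \<tau> k *\<^sub>R vs k) \<longlonglongrightarrow> v)}"

text \<open>\<open>+\<close> is the Minkowski sum.\<close>

definition clarke_subdiff ::
  "'a::euclidean_space set \<Rightarrow> ('a \<Rightarrow> ereal) \<Rightarrow> 'a \<Rightarrow> 'a set" where
  "clarke_subdiff E f x =
     closure (convex hull (limiting_subdiff E f x + horizon_subdiff E f x))"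

text \<open>Unlike \<^const>\<open>infdist\<close>, this is \<open>\<infinity>\<close> for the empty set.\<close>

definition dist0 :: "'a::euclidean_space set \<Rightarrow> ereal" where
  "dist0 S = (INF v\<in>S. ereal (norm v))"

definition has_KL_exponent ::
  "'a::euclidean_space set \<Rightarrow> ('a \<Rightarrow> ereal) \<Rightarrow> real \<Rightarrow> 'a \<Rightarrow> bool" where
  "has_KL_exponent E f \<alpha> x \<longleftrightarrow> 0 \<le> \<alpha> \<and> \<alpha> < 1 \<and> x \<in> edom E f \<and>
     (\<exists>\<rho>>0. \<exists>l>0. \<exists>c>0. \<forall>y \<in> E \<inter> ball x \<rho>.
        0 < f y - f x \<and> f y - f x < ereal l \<longrightarrow>
        dist0 (clarke_subdiff E f y) \<ge> ereal (c * real_of_ereal (f y - f x) powr \<alpha>))"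

subsection \<open>The objective functions\<close>

definition g_asym :: "nat \<Rightarrow> real ^ 'n ^ 'm \<Rightarrow> real ^ 'n ^ 'm \<Rightarrow> ereal" where
  "g_asym r M A = ereal ((norm (A - M))\<^sup>2) + indicator_fun (rank_le_matrices r) A"

definition f_asym ::
  "real ^ 'n ^ 'm \<Rightarrow> (real ^ 'r ^ 'm) \<times> (real ^ 'n ^ 'r) \<Rightarrow> ereal" where
  "f_asym M = (\<lambda>(X, Y). ereal ((norm (X ** Y - M))\<^sup>2))"

definition g_sym :: "nat \<Rightarrow> real ^ 'n ^ 'n \<Rightarrow> real ^ 'n ^ 'n \<Rightarrow> ereal" where
  "g_sym r M A =
     ereal ((norm (A - M))\<^sup>2) + indicator_fun (sym_matrices \<inter> rank_le_matrices r) A"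

definition f_sym :: "real ^ 'n ^ 'n \<Rightarrow> real ^ 'r ^ 'n \<Rightarrow> ereal" where
  "f_sym M X = ereal ((norm (X ** transpose X - M))\<^sup>2)"

end

theory Submission imports Defs begin

text \<open>
  Write \<open>E = A - M\<close>. No subdifferential is ever computed. Along a curve \<open>A + t W A\<close>, which does
  not raise the rank, the objective is a polynomial in \<open>t\<close>, and comparing slopes at \<open>t = 0\<close> shows
  that a regular subgradient \<open>v\<close> at \<open>A\<close> has the same inner product with \<open>W A\<close> as \<open>2 E\<close>. Such an
  identity is affine in \<open>v\<close> and continuous in \<open>A\<close>, and its homogeneous part governs the horizon
  subgradients, so it survives limits, sums, convex hulls and closures and holds for Clarke
  subgradients too (\<open>clarke_subdiff_linear_identity\<close>). The choice \<open>W = E A\<^sup>T\<close>, and its mirror image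
  with \<open>W\<close> on the right, bound the two residuals \<open>E A\<^sup>T\<close> and \<open>A\<^sup>T E\<close> by a multiple of \<open>v\<close>.
  For \<open>A = X Y\<close> one has \<open>E A\<^sup>T = (E Y\<^sup>T) X\<^sup>T\<close>, where \<open>2 E Y\<^sup>T\<close> is a partial gradient of the factorized
  objective, so the factorized problems obey the same residual bounds. Hence all four claims
  follow from one error bound (\<open>low_rank_error_bound\<close>): near a best rank-\<open>r\<close> approximation \<open>A\<^sub>0\<close>
  of \<open>M\<close>, and for small excess, the excess \<open>|A - M|\<^sup>2 - |A\<^sub>0 - M|\<^sup>2\<close> is at most a constant times
  \<open>|E A\<^sup>T|\<^sup>2 + |A\<^sup>T E|\<^sup>2\<close>.

  For the error bound, let \<open>K = M\<^sup>T M\<close> and let \<open>Q\<close> be the orthogonal projection onto the row space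
  of \<open>A\<close>. Pythagoras gives \<open>|E|\<^sup>2 = |E Q|\<^sup>2 + |M|\<^sup>2 - tr (K Q)\<close>, while the least value is \<open>|M|\<^sup>2\<close> minus
  the sum of the \<open>r\<close> largest eigenvalues of \<open>K\<close>. The excess is therefore \<open>|E Q|\<^sup>2\<close> plus the gap
  between \<open>tr (K Q)\<close> and its maximum over projections of rank \<open>r\<close>.

  \<^item> Since \<open>\<sigma>\<^sub>r(M) > 0\<close>, the matrix \<open>A\<^sub>0\<close> has rank exactly \<open>r\<close>. So \<open>A\<^sup>T\<close> can be inverted on its range
    with a bound uniform in \<open>A\<close> near \<open>A\<^sub>0\<close>, and \<open>|E Q|\<close> is at most a constant times \<open>|E A\<^sup>T|\<close>.

  \<^item> In an eigenbasis of \<open>K\<close>, with \<open>\<lambda>\<close> its \<open>r\<close>-th eigenvalue, the trace gap is comparable to the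
    mass that \<open>Q\<close> puts on the eigenvectors below \<open>\<lambda>\<close> plus the mass that \<open>1 - Q\<close> puts on those above.
    A diagonal block of a projection is at most quadratic in its trace, so a small mass must sit
    mostly in an off-diagonal block, and there the commutator \<open>K Q - Q K\<close> sees it because the
    eigenvalues differ. Eigenvalues equal to \<open>\<lambda>\<close> do not contribute to the gap, which is why ties
    at position \<open>r\<close> are harmless although they make the minimizers non-isolated.

  \<^item> The commutator is bounded by \<open>|A\<^sup>T E| + |M| |E Q|\<close>.

  In the symmetric case, positive semidefiniteness of \<open>M\<close> yields a best rank-\<open>r\<close> approximation of
  the form \<open>X X\<^sup>T\<close>. Minimizers of the two symmetric problems are thus minimizers over all matrices
  of rank at most \<open>r\<close>, and the same error bound applies to them.
\<close>

section \<open>The Frobenius inner product\<close>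

lemma bilinear_matrix_mult:
  "bilinear ((**) :: real ^ 'n ^ 'm \<Rightarrow> real ^ 'p ^ 'n \<Rightarrow> real ^ 'p ^ 'm)"
  by (auto simp: bilinear_def matrix_matrix_mult_def vec_eq_iff sum.distrib sum_distrib_left
      algebra_simps intro!: linearI)

interpretation matrix_mult: bounded_bilinear
  "(**) :: real ^ 'n ^ 'm \<Rightarrow> real ^ 'p ^ 'n \<Rightarrow> real ^ 'p ^ 'm"
  using bilinear_conv_bounded_bilinear bilinear_matrix_mult by blast

lemma linear_transpose: "linear (transpose :: real ^ 'n ^ 'm \<Rightarrow> real ^ 'm ^ 'n)"
  by (auto intro!: linearI simp: transpose_def vec_eq_iff)

lemmas transpose_add = linear_add[OF linear_transpose]
  and transpose_diff = linear_diff[OF linear_transpose]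

lemma inner_transpose:
  fixes A B :: "real ^ 'n ^ 'm"
  shows "transpose A \<bullet> transpose B = A \<bullet> B"
  by (simp add: inner_vec_def transpose_def) (rule sum.swap)

lemma norm_transpose: "norm (transpose A) = norm A" for A :: "real ^ 'n ^ 'm"
  by (simp add: norm_eq_sqrt_inner inner_transpose)

lemma inner_matrix_mult_left:
  fixes A :: "real ^ 'p ^ 'm" and B :: "real ^ 'n ^ 'm" and C :: "real ^ 'p ^ 'n"
  shows "A \<bullet> (B ** C) = (transpose B ** A) \<bullet> C"
  by (simp add: inner_matrix_eq_trace matrix_transpose_mul matrix_mul_assoc)

lemma inner_matrix_mult_right:
  fixes A :: "real ^ 'p ^ 'm" and B :: "real ^ 'n ^ 'm" and C :: "real ^ 'p ^ 'n"
  shows "A \<bullet> (B ** C) = (A ** transpose C) \<bullet> B"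
proof -
  have "A \<bullet> (B ** C) = transpose A \<bullet> (transpose C ** transpose B)"
    by (simp add: inner_transpose matrix_transpose_mul[symmetric])
  also have "\<dots> = transpose (A ** transpose C) \<bullet> transpose B"
    by (simp add: inner_matrix_mult_left matrix_transpose_mul)
  finally show ?thesis by (simp add: inner_transpose)
qed

lemma norm_matrix_power2:
  fixes A :: "real ^ 'n ^ 'm"
  shows "(norm A)\<^sup>2 = (\<Sum>i\<in>UNIV. \<Sum>j\<in>UNIV. (A $ i $ j)\<^sup>2)"
  unfolding power2_norm_eq_inner by (simp add: inner_vec_def power2_eq_square)

lemma norm_matrix_power2_rows:
  fixes A :: "real ^ 'n ^ 'm"
  shows "(norm A)\<^sup>2 = (\<Sum>i\<in>UNIV. (norm (A $ i))\<^sup>2)"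
  unfolding power2_norm_eq_inner inner_vec_def[of A] ..

lemma norm_matrix_mult_le:
  fixes A :: "real ^ 'n ^ 'm" and B :: "real ^ 'p ^ 'n"
  shows "norm (A ** B) \<le> norm A * norm B"
proof -
  have "(norm (A ** B))\<^sup>2 = (\<Sum>i\<in>UNIV. \<Sum>j\<in>UNIV. (A $ i \<bullet> transpose B $ j)\<^sup>2)"
    by (simp add: norm_matrix_power2 matrix_matrix_mult_def inner_vec_def transpose_def)
  also have "\<dots> \<le> (\<Sum>i\<in>UNIV. \<Sum>j\<in>UNIV. (norm (A $ i))\<^sup>2 * (norm (transpose B $ j))\<^sup>2)"
    by (intro sum_mono) (metis Cauchy_Schwarz_ineq power2_norm_eq_inner)
  also have "\<dots> = (norm A)\<^sup>2 * (norm (transpose B))\<^sup>2"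
    by (simp add: norm_matrix_power2_rows sum_product)
  finally show ?thesis
    by (simp add: norm_transpose power_mult_distrib[symmetric] abs_le_square_iff[symmetric])
qed

section \<open>Subgradients along curves\<close>

lemma regular_subdiff_lower_bound:
  assumes "v \<in> regular_subdiff E f x" "0 < e"
  obtains d where "0 < d"
    "\<And>y. y \<in> E \<Longrightarrow> norm (y - x) < d \<Longrightarrow> f x + ereal (v \<bullet> (y - x) - e * norm (y - x)) \<le> f y"
proof -
  obtain h :: "'a \<Rightarrow> real" where h: "h \<in> o[at x within E](\<lambda>y. norm (y - x))"
    and ev: "\<forall>\<^sub>F y in at x within E. f y \<ge> f x + ereal (v \<bullet> (y - x) + h y)"
    using assms(1) by (auto simp: regular_subdiff_def)
  have "\<forall>\<^sub>F y in at x within E. norm (h y) \<le> e * norm (norm (y - x))"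
    using landau_o.smallD[OF h \<open>0 < e\<close>] by simp
  with ev have "\<forall>\<^sub>F y in at x within E.
      f x + ereal (v \<bullet> (y - x) - e * norm (y - x)) \<le> f y"
  proof eventually_elim
    case (elim y)
    have "f x + ereal (v \<bullet> (y - x) - e * norm (y - x)) \<le> f x + ereal (v \<bullet> (y - x) + h y)"
      using elim(2) by (intro add_left_mono) auto
    then show ?case using elim(1) by (rule order_trans)
  qed
  then obtain d where "0 < d" and d: "\<And>y. y \<in> E \<Longrightarrow> y \<noteq> x \<Longrightarrow> dist y x < d \<Longrightarrow>
      f x + ereal (v \<bullet> (y - x) - e * norm (y - x)) \<le> f y"
    unfolding eventually_at by auto
  show thesis
  proof (rule that[OF \<open>0 < d\<close>])
    fix y assume "y \<in> E" "norm (y - x) < d"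
    then show "f x + ereal (v \<bullet> (y - x) - e * norm (y - x)) \<le> f y"
      using d[of y] by (cases "y = x") (auto simp: dist_norm zero_ereal_def[symmetric])
  qed
qed

text \<open>
  A subgradient is tested against one-sided curves, and for these the slope of the objective can
  only exceed that of the linear minorant. The terms of second order are there for the symmetric
  objectives, where the matrix compared with \<open>M\<close> moves along a curve of the form \<open>S B S\<^sup>T\<close> with \<open>S\<close>
  affine in \<open>t\<close>, or \<open>X X\<^sup>T\<close> with \<open>X\<close> affine in \<open>t\<close>.
\<close>

lemma regular_subdiff_quadratic_curve_le:
  fixes v w z :: "'a::euclidean_space" and B W Z :: "'b::euclidean_space"
  assumes v: "v \<in> regular_subdiff E f x"
    and E: "\<And>t. x + t *\<^sub>R w + t\<^sup>2 *\<^sub>R z \<in> E"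
    and f: "\<And>t. f (x + t *\<^sub>R w + t\<^sup>2 *\<^sub>R z) = ereal ((norm (B + t *\<^sub>R W + t\<^sup>2 *\<^sub>R Z))\<^sup>2)"
  shows "v \<bullet> w \<le> 2 * (B \<bullet> W)"
proof -
  have fx: "f x = ereal ((norm B)\<^sup>2)" using f[of 0] by simp
  have "v \<bullet> w - e * norm w \<le> 2 * (B \<bullet> W)" if e: "0 < e" for e
  proof -
    obtain d where "0 < d" and d: "\<And>y. y \<in> E \<Longrightarrow> norm (y - x) < d \<Longrightarrow>
        f x + ereal (v \<bullet> (y - x) - e * norm (y - x)) \<le> f y"
      using regular_subdiff_lower_bound[OF v e] by blast
    have "((\<lambda>t. norm (t *\<^sub>R w + t\<^sup>2 *\<^sub>R z)) \<longlongrightarrow> norm (0 *\<^sub>R w + 0\<^sup>2 *\<^sub>R z)) (at_right 0)"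
      by (intro tendsto_intros)
    then have "\<forall>\<^sub>F t in at_right 0. norm (t *\<^sub>R w + t\<^sup>2 *\<^sub>R z) < d"
      using \<open>0 < d\<close> by (intro order_tendstoD(2)) auto
    then have ev: "\<forall>\<^sub>F t in at_right 0. v \<bullet> (w + t *\<^sub>R z) - e * norm (w + t *\<^sub>R z)
        \<le> 2 * (B \<bullet> W) + t * (W \<bullet> W + 2 * (B \<bullet> Z) + 2 * t * (W \<bullet> Z) + t\<^sup>2 * (Z \<bullet> Z))"
      using eventually_at_right_less[of 0]
    proof eventually_elim
      case (elim t)
      have *: "t *\<^sub>R w + t\<^sup>2 *\<^sub>R z = t *\<^sub>R (w + t *\<^sub>R z)"
        by (simp add: algebra_simps power2_eq_square)
      have "(norm B)\<^sup>2 + (v \<bullet> (t *\<^sub>R (w + t *\<^sub>R z)) - e * norm (t *\<^sub>R (w + t *\<^sub>R z)))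
          \<le> (norm (B + t *\<^sub>R W + t\<^sup>2 *\<^sub>R Z))\<^sup>2"
        using d[OF E, of t] elim(1) unfolding f fx by (simp add: add.assoc * del: scaleR_add_right)
      also have "\<dots> = (norm B)\<^sup>2 + t * (2 * (B \<bullet> W) +
          t * (W \<bullet> W + 2 * (B \<bullet> Z) + 2 * t * (W \<bullet> Z) + t\<^sup>2 * (Z \<bullet> Z)))"
        unfolding power2_norm_eq_inner
        by (simp add: inner_simps inner_commute algebra_simps power2_eq_square)
      finally have "t * (v \<bullet> (w + t *\<^sub>R z) - e * norm (w + t *\<^sub>R z)) \<le> t * (2 * (B \<bullet> W) +
          t * (W \<bullet> W + 2 * (B \<bullet> Z) + 2 * t * (W \<bullet> Z) + t\<^sup>2 * (Z \<bullet> Z)))"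
        using elim(2) by (simp add: right_diff_distrib mult.left_commute del: scaleR_add_right)
      then show ?case using elim(2) by simp
    qed
    have "((\<lambda>t. v \<bullet> (w + t *\<^sub>R z) - e * norm (w + t *\<^sub>R z)) \<longlongrightarrow>
        v \<bullet> (w + 0 *\<^sub>R z) - e * norm (w + 0 *\<^sub>R z)) (at_right 0)"
      by (intro tendsto_intros)
    moreover have "((\<lambda>t. 2 * (B \<bullet> W) + t * (W \<bullet> W + 2 * (B \<bullet> Z) + 2 * t * (W \<bullet> Z) + t\<^sup>2 * (Z \<bullet> Z)))
        \<longlongrightarrow> 2 * (B \<bullet> W) + 0 * (W \<bullet> W + 2 * (B \<bullet> Z) + 2 * 0 * (W \<bullet> Z) + 0\<^sup>2 * (Z \<bullet> Z))) (at_right 0)"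
      by (intro tendsto_intros)
    ultimately show ?thesis
      using tendsto_le[OF trivial_limit_at_right_real _ _ ev] by force
  qed
  then have "\<forall>\<^sub>F e in at_right 0. v \<bullet> w - e * norm w \<le> 2 * (B \<bullet> W)"
    using eventually_at_right_less[of "0::real"] by (auto elim: eventually_mono)
  moreover have "((\<lambda>e. v \<bullet> w - e * norm w) \<longlongrightarrow> v \<bullet> w - 0 * norm w) (at_right 0)"
    by (intro tendsto_intros)
  ultimately show ?thesis
    using tendsto_upperbound[OF _ _ trivial_limit_at_right_real,
      of "\<lambda>e. v \<bullet> w - e * norm w"] by simp
qed

text \<open>
  Reversing the curve turns the one-sided inequality into an equation. Only the
  values of \<open>f\<close> on the curve matter, so an infinite value elsewhere does no harm.
\<close>

lemma regular_subdiff_quadratic_curve: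
  fixes v w z :: "'a::euclidean_space" and B W Z :: "'b::euclidean_space"
  assumes v: "v \<in> regular_subdiff E f x"
    and E: "\<And>t. x + t *\<^sub>R w + t\<^sup>2 *\<^sub>R z \<in> E"
    and f: "\<And>t. f (x + t *\<^sub>R w + t\<^sup>2 *\<^sub>R z) = ereal ((norm (B + t *\<^sub>R W + t\<^sup>2 *\<^sub>R Z))\<^sup>2)"
  shows "v \<bullet> w = 2 * (B \<bullet> W)"
proof (rule antisym)
  show "v \<bullet> w \<le> 2 * (B \<bullet> W)"
    using regular_subdiff_quadratic_curve_le[OF v E f] .
  have "v \<bullet> (- w) \<le> 2 * (B \<bullet> (- W))"
  proof (rule regular_subdiff_quadratic_curve_le[OF v])
    show "x + t *\<^sub>R (- w) + t\<^sup>2 *\<^sub>R z \<in> E" for t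
      using E[of "- t"] by simp
    show "f (x + t *\<^sub>R (- w) + t\<^sup>2 *\<^sub>R z) = ereal ((norm (B + t *\<^sub>R (- W) + t\<^sup>2 *\<^sub>R Z))\<^sup>2)" for t
      using f[of "- t"] by simp
  qed
  then show "2 * (B \<bullet> W) \<le> v \<bullet> w" by simp
qed

text \<open>
  The affine hyperplane of those \<open>v\<close> with \<open>v \<bullet> T x = c x\<close> is closed and convex. Limiting subgradients
  lie in it by continuity of \<open>T\<close> and \<open>c\<close>; for horizon subgradients the scaling factors tend to \<open>0\<close>
  and turn the right-hand side into \<open>0\<close>, so that adding them does not leave the hyperplane.
\<close>

lemma clarke_subdiff_linear_identity:
  fixes T :: "'a::euclidean_space \<Rightarrow> 'a"
  assumes T: "isCont T x" and c: "isCont c x"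
    and reg: "\<And>y v. v \<in> regular_subdiff E f y \<Longrightarrow> v \<bullet> T y = c y"
    and v: "v \<in> clarke_subdiff E f x"
  shows "v \<bullet> T x = c x"
proof -
  have lim: "u \<bullet> T x = c x" if u: "u \<in> limiting_subdiff E f x" for u
  proof -
    obtain xs vs where r: "\<And>k::nat. vs k \<in> regular_subdiff E f (xs k)"
      and xs: "xs \<longlonglongrightarrow> x" and vs: "vs \<longlonglongrightarrow> u"
      using u unfolding limiting_subdiff_def by blast
    have "(\<lambda>k. vs k \<bullet> T (xs k)) \<longlonglongrightarrow> u \<bullet> T x"
      by (intro tendsto_intros vs isCont_tendsto_compose[OF T xs])
    moreover have "(\<lambda>k. vs k \<bullet> T (xs k)) \<longlonglongrightarrow> c x"
      using isCont_tendsto_compose[OF c xs] reg[OF r] by simp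
    ultimately show ?thesis by (rule LIMSEQ_unique)
  qed
  have hor: "u \<bullet> T x = 0" if u: "u \<in> horizon_subdiff E f x" for u
  proof -
    obtain xs vs and \<tau> :: "nat \<Rightarrow> real"
      where r: "\<And>k::nat. vs k \<in> regular_subdiff E f (xs k)" and \<tau>: "\<tau> \<longlonglongrightarrow> 0"
      and xs: "xs \<longlonglongrightarrow> x" and vs: "(\<lambda>k. \<tau> k *\<^sub>R vs k) \<longlonglongrightarrow> u"
      using u unfolding horizon_subdiff_def by blast
    have "(\<lambda>k. (\<tau> k *\<^sub>R vs k) \<bullet> T (xs k)) \<longlonglongrightarrow> u \<bullet> T x"
      by (intro tendsto_intros vs isCont_tendsto_compose[OF T xs])
    moreover have "(\<lambda>k. (\<tau> k *\<^sub>R vs k) \<bullet> T (xs k)) \<longlonglongrightarrow> 0 * c x"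
      using tendsto_mult[OF \<tau> isCont_tendsto_compose[OF c xs]] reg[OF r] by simp
    ultimately show ?thesis using LIMSEQ_unique by fastforce
  qed
  let ?H = "{u. T x \<bullet> u = c x}"
  have "limiting_subdiff E f x + horizon_subdiff E f x \<subseteq> ?H"
    using lim hor by (auto simp: set_plus_def inner_commute inner_right_distrib)
  then have "clarke_subdiff E f x \<subseteq> ?H"
    unfolding clarke_subdiff_def
    by (intro closure_minimal hull_minimal) (auto simp: closed_hyperplane convex_hyperplane)
  with v show ?thesis by (auto simp: inner_commute)
qed

lemma KL_exponent_half_if_sq_error_bound:
  fixes x :: "'a::euclidean_space"
  assumes x: "x \<in> E" "f x = ereal a"
    and "0 < \<rho>" "0 < l" "0 < C"
    and bound: "\<And>y b v. y \<in> E \<Longrightarrow> dist x y < \<rho> \<Longrightarrow> f y = ereal b \<Longrightarrow> a < b \<Longrightarrow> b < a + l \<Longrightarrow>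
      v \<in> clarke_subdiff E f y \<Longrightarrow> b - a \<le> C * (norm v)\<^sup>2"
  shows "has_KL_exponent E f (1/2) x"
proof -
  have "ereal (1 / sqrt C * real_of_ereal (f y - f x) powr (1/2)) \<le> dist0 (clarke_subdiff E f y)"
    if y: "y \<in> E \<inter> ball x \<rho>" "0 < f y - f x" "f y - f x < ereal l" for y
  proof -
    from y(2,3) x(2) obtain b where b: "f y = ereal b" by (cases "f y") auto
    have "1 / sqrt C * sqrt (b - a) \<le> norm v" if "v \<in> clarke_subdiff E f y" for v
    proof -
      have "sqrt (b - a) \<le> sqrt (C * (norm v)\<^sup>2)"
        using bound[OF _ _ b _ _ that] y b x(2) by (intro real_sqrt_le_mono) auto
      then show ?thesis using \<open>0 < C\<close> by (simp add: real_sqrt_mult field_simps)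
    qed
    then show ?thesis
      using y(2) b x(2) unfolding dist0_def by (auto intro!: INF_greatest simp: powr_half_sqrt)
  qed
  moreover have "0 < 1 / sqrt C" using \<open>0 < C\<close> by simp
  ultimately have "\<exists>\<rho>>0. \<exists>l>0. \<exists>c>0. \<forall>y \<in> E \<inter> ball x \<rho>. 0 < f y - f x \<and> f y - f x < ereal l \<longrightarrow>
      dist0 (clarke_subdiff E f y) \<ge> ereal (c * real_of_ereal (f y - f x) powr (1/2))"
    using \<open>0 < \<rho>\<close> \<open>0 < l\<close> by blast
  then show ?thesis
    using x unfolding has_KL_exponent_def edom_def by simp
qed

section \<open>Diagonalization of symmetric matrices\<close>

lemma symmetric_matrix_inner:
  fixes K :: "real ^ 'n ^ 'n"
  assumes "transpose K = K"
  shows "(K *v x) \<bullet> y = x \<bullet> (K *v y)"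
  by (metis assms dot_lmul_matrix vector_transpose_matrix)

text \<open>
  A maximizer \<open>x\<close> of the quadratic form on the unit sphere of the subspace is an eigenvector: the
  component \<open>z\<close> of \<open>K x\<close> orthogonal to \<open>x\<close> lies in the subspace again, and moving from \<open>x\<close> in its
  direction would increase the form at first order in the step unless \<open>z = 0\<close>.
\<close>

lemma symmetric_matrix_eigenvector_in_invariant_subspace:
  fixes K :: "real ^ 'n ^ 'n"
  assumes sym: "transpose K = K" and V: "subspace V" "V \<noteq> {0}"
    and inv: "\<And>x. x \<in> V \<Longrightarrow> K *v x \<in> V"
  obtains x t where "x \<in> V" "norm x = 1" "K *v x = t *\<^sub>R x"
proof -
  let ?S = "V \<inter> sphere 0 1"
  obtain y where y: "y \<in> V" "y \<noteq> 0" using V subspace_0 by blast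
  then have "y /\<^sub>R norm y \<in> ?S" using V by (simp add: subspace_scale)
  moreover have "compact ?S" using V(1) by (simp add: closed_Int_compact closed_subspace)
  moreover have "continuous_on ?S (\<lambda>x. x \<bullet> (K *v x))"
    by (intro continuous_intros linear_continuous_on) auto
  ultimately have "\<exists>x\<in>?S. \<forall>y\<in>?S. y \<bullet> (K *v y) \<le> x \<bullet> (K *v x)"
    by (intro continuous_attains_sup) auto
  then obtain x where x: "x \<in> ?S" and max: "\<And>y. y \<in> ?S \<Longrightarrow> y \<bullet> (K *v y) \<le> x \<bullet> (K *v x)"
    by (elim bexE) (simp only: ball_simps)
  define t where "t = x \<bullet> (K *v x)"
  have form: "y \<bullet> (K *v y) \<le> t * (y \<bullet> y)" if "y \<in> V" for y
  proof (cases "y = 0")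
    case False
    have "y /\<^sub>R norm y \<in> ?S" using False that V by (simp add: subspace_scale)
    from max[OF this] have "(y \<bullet> (K *v y)) / (norm y)\<^sup>2 \<le> t"
      by (simp add: t_def matrix_vector_mult_scaleR power2_eq_square divide_inverse mult_ac)
    then show ?thesis using False by (simp add: divide_le_eq power2_norm_eq_inner)
  qed simp
  define z where "z = K *v x - t *\<^sub>R x"
  have "z \<in> V" using x V inv by (simp add: z_def subspace_diff subspace_scale)
  have xx: "x \<bullet> x = 1" using x by (simp add: norm_eq_sqrt_inner)
  have zx: "z \<bullet> x = 0" by (simp add: z_def inner_diff_left xx t_def inner_commute[of "K *v x"])
  have Kx: "K *v x = z + t *\<^sub>R x" by (simp add: z_def)
  have "s * (2 * (z \<bullet> z)) \<le> s\<^sup>2 * (t * (z \<bullet> z) - z \<bullet> (K *v z))" for s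
  proof -
    have "x + s *\<^sub>R z \<in> V" using x V \<open>z \<in> V\<close> by (simp add: subspace_add subspace_scale)
    from form[OF this] have "x \<bullet> (K *v x) + s * (x \<bullet> (K *v z)) + s * (z \<bullet> (K *v x)) + s\<^sup>2 * (z \<bullet> (K *v z))
       \<le> t * (x \<bullet> x + 2 * s * (z \<bullet> x) + s\<^sup>2 * (z \<bullet> z))"
      by (simp add: matrix_vector_mult_scaleR matrix_vector_right_distrib inner_simps
          inner_commute power2_eq_square algebra_simps)
    moreover have "x \<bullet> (K *v z) = z \<bullet> z" "z \<bullet> (K *v x) = z \<bullet> z"
      using symmetric_matrix_inner[OF sym, of x z] by (simp_all add: Kx inner_simps zx inner_commute[of x z])
    ultimately show ?thesis using xx zx by (simp add: t_def[symmetric] algebra_simps)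
  qed
  then have nonpos: "\<forall>\<^sub>F s in at_right 0. 2 * (z \<bullet> z) \<le> s * (t * (z \<bullet> z) - z \<bullet> (K *v z))"
    by (intro eventually_mono[OF eventually_at_right_less])
      (metis (no_types, lifting) power2_eq_square mult.assoc mult_le_cancel_left_pos)
  have "((\<lambda>s. s * (t * (z \<bullet> z) - z \<bullet> (K *v z))) \<longlongrightarrow> 0 * (t * (z \<bullet> z) - z \<bullet> (K *v z))) (at_right 0)"
    by (intro tendsto_intros)
  then have "2 * (z \<bullet> z) \<le> 0"
    using tendsto_lowerbound[OF _ nonpos] by simp
  then have "z = 0" by (metis inner_ge_zero inner_eq_zero_iff antisym mult_le_0_iff not_numeral_le_zero)
  then show thesis using that x Kx by auto
qed

text \<open>
  The orthogonal complement of a set of eigenvectors is invariant under \<open>K\<close>, so it contains a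
  further eigenvector unless it is trivial. An orthonormal set of eigenvectors of maximal size is
  therefore a basis; it forms the rows of \<open>U\<close>.
\<close>

lemma symmetric_matrix_diagonalization:
  fixes K :: "real ^ 'n ^ 'n"
  assumes sym: "transpose K = K"
  obtains U :: "real ^ 'n ^ 'n" and k :: "'n \<Rightarrow> real"
  where "orthogonal_matrix U" "\<And>i. K *v (U $ i) = k i *\<^sub>R U $ i"
proof -
  define P where "P B \<longleftrightarrow> pairwise orthogonal B \<and> (\<forall>b\<in>B. norm b = 1 \<and> (\<exists>t. K *v b = t *\<^sub>R b))"
    for B :: "(real ^ 'n) set"
  have indep: "independent B" if "P B" for B
    using that pairwise_orthogonal_independent[of B] by (force simp: P_def)
  have card: "card B \<le> CARD('n)" "finite B" if "P B" for B
    using independent_bound[OF indep[OF that]] by auto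
  have "P {}" by (simp add: P_def)
  moreover have "\<forall>C. P C \<longrightarrow> card C < Suc CARD('n)" using card(1) by (simp add: less_Suc_eq_le)
  ultimately obtain B where B: "P B" and max: "\<And>C. P C \<Longrightarrow> card C \<le> card B"
    using ex_has_greatest_nat[of P "{}" card "Suc CARD('n)"] by (meson less_imp_le)
  have "card B = CARD('n)"
  proof (rule ccontr)
    assume "card B \<noteq> CARD('n)"
    then have "dim B < DIM(real ^ 'n)" using card[OF B] dim_eq_card_independent[OF indep[OF B]] by simp
    then obtain y where y: "y \<noteq> 0" "\<And>b. b \<in> span B \<Longrightarrow> orthogonal y b"
      using orthogonal_to_subspace_exists[of B] by blast
    let ?V = "{x. \<forall>b\<in>B. b \<bullet> x = 0}"
    have V: "subspace ?V" by (auto simp: subspace_def inner_simps)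
    have V0: "?V \<noteq> {0}"
    proof -
      have "y \<in> ?V" using y(2) span_base by (auto simp: orthogonal_def inner_commute)
      then show ?thesis using y(1) by blast
    qed
    have inv: "K *v x \<in> ?V" if "x \<in> ?V" for x
    proof -
      have "b \<bullet> (K *v x) = 0" if b: "b \<in> B" for b
      proof -
        obtain t where "K *v b = t *\<^sub>R b" using B b by (auto simp: P_def)
        then show ?thesis
          using symmetric_matrix_inner[OF sym, of b x] \<open>x \<in> ?V\<close> b by simp
      qed
      then show ?thesis by simp
    qed
    obtain x t where x: "x \<in> ?V" "norm x = 1" "K *v x = t *\<^sub>R x"
      by (rule symmetric_matrix_eigenvector_in_invariant_subspace[OF sym V V0 inv])
    have "x \<notin> B"
    proof
      assume "x \<in> B"
      then have "x \<bullet> x = 0" using x(1) by blast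
      then show False using x(2) by simp
    qed
    moreover have "P (insert x B)"
      using B x by (auto simp: P_def pairwise_insert orthogonal_def inner_commute)
    ultimately show False using max[of "insert x B"] card(2)[OF B] by simp
  qed
  then obtain f :: "'n \<Rightarrow> real ^ 'n" where f: "bij_betw f UNIV B"
    using finite_same_card_bij[of "UNIV :: 'n set" B] card[OF B] by auto
  have "\<forall>i. \<exists>t. K *v f i = t *\<^sub>R f i" using B f by (auto simp: P_def bij_betw_def)
  then obtain k where k: "\<And>i. K *v f i = k i *\<^sub>R f i" by metis
  have "orthogonal_matrix (\<chi> i. f i)"
    unfolding orthogonal_matrix_orthonormal_rows
    using B f by (auto simp: row_def P_def bij_betw_def pairwise_def inj_eq)
  then show thesis using that[of "\<chi> i. f i" k] k by simp
qed

section \<open>Orthogonal projections\<close>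

definition orth_projection :: "real ^ 'n ^ 'n \<Rightarrow> bool" where
  "orth_projection Q \<longleftrightarrow> transpose Q = Q \<and> Q ** Q = Q"

lemma orth_projection_onto_subspace:
  fixes V :: "(real ^ 'n) set"
  assumes "subspace V"
  obtains Q where "orth_projection Q" "\<And>x. Q *v x \<in> V" "\<And>x. x \<in> V \<Longrightarrow> Q *v x = x"
    "trace Q = real (dim V)"
proof -
  obtain B where B: "B \<subseteq> V" "pairwise orthogonal B" "\<And>x. x \<in> B \<Longrightarrow> norm x = 1"
    "independent B" "card B = dim V" "span B = V"
    using orthonormal_basis_subspace[OF assms] by blast
  have fin: "finite B" using B(4) independent_imp_finite by blast
  define Q :: "real ^ 'n ^ 'n" where "Q = (\<chi> i j. \<Sum>b\<in>B. b $ i * b $ j)"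
  have Q: "Q *v x = (\<Sum>b\<in>B. (b \<bullet> x) *\<^sub>R b)" for x
  proof -
    have "(\<Sum>j\<in>UNIV. (\<Sum>b\<in>B. b $ i * b $ j) * x $ j) = (\<Sum>b\<in>B. (\<Sum>j\<in>UNIV. b $ j * x $ j) * b $ i)" for i
      unfolding sum_distrib_right by (subst sum.swap) (simp add: mult_ac)
    then show ?thesis
      by (simp add: Q_def vec_eq_iff matrix_vector_mult_def inner_vec_def)
  qed
  have onB: "Q *v b = b" if "b \<in> B" for b
  proof -
    have "(c \<bullet> b) *\<^sub>R c = (if c = b then b else 0)" if "c \<in> B" for c
      using B(2,3) \<open>b \<in> B\<close> that by (auto simp: pairwise_def orthogonal_def norm_eq_1)
    then show ?thesis using \<open>b \<in> B\<close> fin by (simp add: Q cong: sum.cong)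
  qed
  have inV: "Q *v x \<in> V" for x
    unfolding Q by (metis (no_types, lifting) B(6) span_base span_scale span_sum)
  have onV: "Q *v x = x" if "x \<in> V" for x
  proof -
    have "x \<in> span B" using that B by simp
    then show ?thesis
      using linear_eq_on_span[of "(*v) Q" id B x] onB linear_id by simp
  qed
  have "Q ** Q = Q"
    unfolding matrix_eq using onV inV by (simp add: matrix_vector_mul_assoc[symmetric])
  moreover have "transpose Q = Q" by (simp add: Q_def transpose_def mult_ac)
  moreover have "trace Q = real (dim V)"
  proof -
    have "trace Q = (\<Sum>b\<in>B. b \<bullet> b)"
      by (simp add: trace_def Q_def inner_vec_def) (rule sum.swap)
    then show ?thesis using B(3,5) by (simp add: norm_eq_1)
  qed
  ultimately show thesis using that inV onV by (simp add: orth_projection_def)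
qed

lemma orth_projection_complement:
  "orth_projection Q \<Longrightarrow> orth_projection (mat 1 - Q)"
  by (simp add: orth_projection_def transpose_diff matrix_mult.diff_left matrix_mult.diff_right)

lemma orth_projection_diag:
  assumes "orth_projection Q"
  shows "Q $ i $ i = (\<Sum>j\<in>UNIV. (Q $ i $ j)\<^sup>2)"
proof -
  have "Q $ j $ i = Q $ i $ j" for j
    using assms unfolding orth_projection_def transpose_def by (metis vec_lambda_beta)
  then have "(Q ** Q) $ i $ i = (\<Sum>j\<in>UNIV. (Q $ i $ j)\<^sup>2)"
    by (simp add: matrix_matrix_mult_def power2_eq_square)
  then show ?thesis using assms by (simp add: orth_projection_def)
qed

lemma orth_projection_diag_nonneg: "orth_projection Q \<Longrightarrow> 0 \<le> Q $ i $ i"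
  by (simp add: orth_projection_diag sum_nonneg)

lemma orth_projection_diag_le_1: "orth_projection Q \<Longrightarrow> Q $ i $ i \<le> 1"
  using orth_projection_diag_nonneg[OF orth_projection_complement, of Q i] by (simp add: mat_def)

text \<open>
  \<open>Q = Q Q\<^sup>T\<close> is the Gram matrix of its own rows, so this is the Cauchy-Schwarz inequality.
\<close>

lemma orth_projection_minor:
  assumes "orth_projection Q"
  shows "(Q $ i $ j)\<^sup>2 \<le> Q $ i $ i * Q $ j $ j"
proof -
  have s: "Q $ k $ j = Q $ j $ k" for k
    using assms unfolding orth_projection_def transpose_def by (metis vec_lambda_beta)
  have "Q $ i $ j = (Q ** Q) $ i $ j" using assms by (simp add: orth_projection_def)
  also have "\<dots> = Q $ i \<bullet> Q $ j" by (simp add: matrix_matrix_mult_def inner_vec_def s)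
  finally have "(Q $ i $ j)\<^sup>2 \<le> (Q $ i \<bullet> Q $ i) * (Q $ j \<bullet> Q $ j)"
    using Cauchy_Schwarz_ineq[of "Q $ i" "Q $ j"] by simp
  moreover have "Q $ k \<bullet> Q $ k = Q $ k $ k" for k
    using orth_projection_diag[OF assms, of k] by (simp add: inner_vec_def power2_eq_square)
  ultimately show ?thesis by simp
qed

text \<open>
  The squares in row \<open>i\<close> add up to \<open>Q\<^sub>i\<^sub>i\<close>. If \<open>x\<close> is the trace of the block \<open>J \<times> J\<close>, then the squares
  inside this block add up to at most \<open>x\<^sup>2\<close>, which is at most \<open>x / 2\<close>, and the other half of the
  mass has to lie outside the block.
\<close>

lemma orth_projection_small_block:
  assumes Q: "orth_projection Q" and small: "(\<Sum>i\<in>J. Q $ i $ i) \<le> 1/2"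
  shows "(\<Sum>i\<in>J. Q $ i $ i) \<le> 2 * (\<Sum>i\<in>J. \<Sum>j\<in>-J. (Q $ i $ j)\<^sup>2)"
proof -
  let ?x = "\<Sum>i\<in>J. Q $ i $ i"
  have "?x = (\<Sum>i\<in>J. (\<Sum>j\<in>J. (Q $ i $ j)\<^sup>2) + (\<Sum>j\<in>-J. (Q $ i $ j)\<^sup>2))"
  proof (intro sum.cong refl)
    fix i
    show "Q $ i $ i = (\<Sum>j\<in>J. (Q $ i $ j)\<^sup>2) + (\<Sum>j\<in>-J. (Q $ i $ j)\<^sup>2)"
      unfolding orth_projection_diag[OF Q, of i]
      by (subst sum.union_disjoint[symmetric]) (auto simp: Compl_partition)
  qed
  moreover have "(\<Sum>i\<in>J. \<Sum>j\<in>J. (Q $ i $ j)\<^sup>2) \<le> (\<Sum>i\<in>J. \<Sum>j\<in>J. Q $ i $ i * Q $ j $ j)"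
    by (intro sum_mono orth_projection_minor Q)
  moreover have "(\<Sum>i\<in>J. \<Sum>j\<in>J. Q $ i $ i * Q $ j $ j) = ?x * ?x"
    by (simp add: sum_product)
  moreover have "?x * ?x \<le> ?x * (1/2)"
    using small by (intro mult_left_mono) (auto intro!: sum_nonneg orth_projection_diag_nonneg Q)
  ultimately show ?thesis by (simp add: sum.distrib)
qed

lemma norm_orth_projection_split:
  fixes A :: "real ^ 'n ^ 'm"
  assumes "orth_projection Q"
  shows "(norm A)\<^sup>2 = (norm (A ** Q))\<^sup>2 + (norm (A ** (mat 1 - Q)))\<^sup>2"
proof -
  have "(A ** Q) \<bullet> (A ** (mat 1 - Q)) = (A ** (Q ** (mat 1 - Q))) \<bullet> A"
    using orth_projection_complement[OF assms]
    by (simp add: inner_matrix_mult_right orth_projection_def matrix_mul_assoc)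
  also have "Q ** (mat 1 - Q) = 0"
    using assms by (simp add: orth_projection_def matrix_mult.diff_right)
  finally have "orthogonal (A ** Q) (A ** (mat 1 - Q))"
    by (simp add: orthogonal_def matrix_mult.zero_right)
  from norm_add_Pythagorean[OF this] show ?thesis
    by (simp add: matrix_mult.diff_right)
qed

lemma norm_mult_complement_le:
  fixes A :: "real ^ 'n ^ 'm"
  assumes "orth_projection Q"
  shows "norm (A ** (mat 1 - Q)) \<le> norm A"
proof (rule power2_le_imp_le)
  show "(norm (A ** (mat 1 - Q)))\<^sup>2 \<le> (norm A)\<^sup>2"
    unfolding norm_orth_projection_split[OF assms, of A] by simp
qed simp

section \<open>The trace gap of a projection and its commutator\<close>

text \<open>
  Since \<open>Q\<close> has as much trace as \<open>I\<close> has elements, \<open>t\<close> may be subtracted from every \<open>k i\<close>. Afterwards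
  all terms are nonnegative if \<open>Q\<close> is an orthogonal projection, and indices with \<open>k i = t\<close> drop out.
\<close>

lemma trace_gap_eq:
  fixes k :: "'n::finite \<Rightarrow> real" and Q :: "real ^ 'n ^ 'n"
  assumes "trace Q = real (card I)"
    and up: "\<And>i. i \<in> I \<Longrightarrow> t \<le> k i" and lo: "\<And>i. i \<notin> I \<Longrightarrow> k i \<le> t"
  shows "(\<Sum>i\<in>I. k i) - (\<Sum>i\<in>UNIV. k i * Q $ i $ i) =
    (\<Sum>i\<in>UNIV. \<bar>k i - t\<bar> * (if i \<in> I then 1 - Q $ i $ i else Q $ i $ i))"
proof -
  have "(\<Sum>i\<in>UNIV. \<bar>k i - t\<bar> * (if i \<in> I then 1 - Q $ i $ i else Q $ i $ i)) =
      (\<Sum>i\<in>UNIV. (if i \<in> I then k i - t else 0) - k i * Q $ i $ i + t * Q $ i $ i)"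
  proof (intro sum.cong refl)
    fix i
    show "\<bar>k i - t\<bar> * (if i \<in> I then 1 - Q $ i $ i else Q $ i $ i) =
        (if i \<in> I then k i - t else 0) - k i * Q $ i $ i + t * Q $ i $ i"
      using up[of i] lo[of i] by (cases "i \<in> I") (simp_all add: algebra_simps)
  qed
  also have "\<dots> = (\<Sum>i\<in>I. k i - t) - (\<Sum>i\<in>UNIV. k i * Q $ i $ i) + t * trace Q"
    by (simp add: sum.distrib sum_subtractf sum_distrib_left trace_def sum.If_cases)
  finally show ?thesis using assms(1) by (simp add: sum_subtractf)
qed

text \<open>
  For diagonal \<open>K\<close> with entries \<open>k\<close>, the double sum is \<open>|K Q - Q K|\<^sup>2\<close>. The bound is quadratic in the
  commutator, which is the source of the exponent \<open>1/2\<close>. It needs the gap to be small: every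
  projection that commutes with \<open>K\<close> is a critical point of the trace, not only the maximizers.
\<close>

lemma trace_gap_le_commutator:
  fixes k :: "'n::finite \<Rightarrow> real"
  assumes up: "\<And>i. i \<in> I \<Longrightarrow> t \<le> k i" and lo: "\<And>i. i \<notin> I \<Longrightarrow> k i \<le> t"
  obtains l C where "0 < l" "0 < C"
    "\<And>Q :: real ^ 'n ^ 'n. orth_projection Q \<Longrightarrow> trace Q = real (card I) \<Longrightarrow>
      (\<Sum>i\<in>I. k i) - (\<Sum>i\<in>UNIV. k i * Q $ i $ i) < l \<Longrightarrow>
      (\<Sum>i\<in>I. k i) - (\<Sum>i\<in>UNIV. k i * Q $ i $ i)
        \<le> C * (\<Sum>i\<in>UNIV. \<Sum>j\<in>UNIV. ((k i - k j) * Q $ i $ j)\<^sup>2)"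
proof -
  \<comment> \<open>\<open>\<gamma>\<close> and \<open>\<Gamma>\<close> are the least nonzero and the greatest distance of the \<open>k i\<close> to \<open>t\<close>; the inserted
    \<open>1\<close> keeps the sets nonempty and makes both constants positive\<close>
  define \<gamma> where "\<gamma> = Min (insert 1 ((\<lambda>i. \<bar>k i - t\<bar>) ` {i. k i \<noteq> t}))"
  define \<Gamma> where "\<Gamma> = Max (insert 1 ((\<lambda>i. \<bar>k i - t\<bar>) ` UNIV))"
  have \<gamma>: "0 < \<gamma>" "\<And>i. k i \<noteq> t \<Longrightarrow> \<gamma> \<le> \<bar>k i - t\<bar>" unfolding \<gamma>_def by auto
  have \<Gamma>: "1 \<le> \<Gamma>" "\<And>i. \<bar>k i - t\<bar> \<le> \<Gamma>" unfolding \<Gamma>_def by (rule Max_ge; simp)+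
  define L where "L = {i. k i < t}"
  define G where "G = {i. t < k i}"
  have GI: "G \<subseteq> I" and LI: "L \<inter> I = {}" and GL: "G \<inter> L = {}"
    using up lo by (force simp: G_def L_def)+
  show thesis
  \<comment> \<open>a gap below \<open>\<gamma> / 2\<close> makes the mass on \<open>G\<close> and \<open>L\<close> together smaller than \<open>1/2\<close>\<close>
  proof (rule that[of "\<gamma> / 2" "4 * \<Gamma> / \<gamma>\<^sup>2"])
    fix Q :: "real ^ 'n ^ 'n"
    let ?d = "(\<Sum>i\<in>I. k i) - (\<Sum>i\<in>UNIV. k i * Q $ i $ i)"
    let ?S = "\<Sum>i\<in>UNIV. \<Sum>j\<in>UNIV. ((k i - k j) * Q $ i $ j)\<^sup>2"
    assume Q: "orth_projection Q" and tr: "trace Q = real (card I)" and d: "?d < \<gamma> / 2"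
    let ?x = "\<Sum>i\<in>L. Q $ i $ i" and ?y = "\<Sum>i\<in>G. (mat 1 - Q) $ i $ i"
    have Q': "orth_projection (mat 1 - Q)" by (rule orth_projection_complement[OF Q])
    have nonneg: "0 \<le> ?x" "0 \<le> ?y"
      using orth_projection_diag_nonneg[OF Q] orth_projection_diag_nonneg[OF Q'] by (auto intro: sum_nonneg)
    define w where "w i = (if i \<in> I then 1 - Q $ i $ i else Q $ i $ i)" for i
    have w: "0 \<le> w i" for i
      using orth_projection_diag_nonneg[OF Q] orth_projection_diag_le_1[OF Q] by (simp add: w_def)
    have "?d = (\<Sum>i\<in>UNIV. \<bar>k i - t\<bar> * w i)"
      unfolding w_def by (rule trace_gap_eq[OF tr up lo])
    also have "\<dots> = (\<Sum>i\<in>G \<union> L. \<bar>k i - t\<bar> * w i)"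
      by (rule sum.mono_neutral_right) (auto simp: G_def L_def)
    finally have d_eq: "?d = (\<Sum>i\<in>G \<union> L. \<bar>k i - t\<bar> * w i)" .
    have xy: "(\<Sum>i\<in>G \<union> L. w i) = ?y + ?x"
      using GI LI GL by (subst sum.union_disjoint) (auto simp: w_def mat_def intro!: arg_cong2[of _ _ _ _ "(+)"] sum.cong)
    have lower: "\<gamma> * (?y + ?x) \<le> ?d"
      unfolding d_eq xy[symmetric] sum_distrib_left
      by (intro sum_mono mult_right_mono w \<gamma>) (auto simp: G_def L_def)
    have upper: "?d \<le> \<Gamma> * (?y + ?x)"
      unfolding d_eq xy[symmetric] sum_distrib_left by (intro sum_mono mult_right_mono w \<Gamma>)
    have small: "?x \<le> 1/2" "?y \<le> 1/2"
    proof -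
      have "\<gamma> * (?y + ?x) < \<gamma> * (1/2)" using lower d by linarith
      then have "?y + ?x < 1/2" using \<gamma>(1) by (simp only: mult_less_cancel_left_pos)
      then show "?x \<le> 1/2" "?y \<le> 1/2" using nonneg by auto
    qed
    \<comment> \<open>used for \<open>R = Q\<close> on \<open>L\<close> and for \<open>R = 1 - Q\<close> on \<open>G\<close>, which agree with \<open>Q\<close> off the diagonal up to sign\<close>
    have block: "\<gamma>\<^sup>2 * (\<Sum>i\<in>J. \<Sum>j\<in>-J. (R $ i $ j)\<^sup>2) \<le> ?S"
      if J: "\<And>i j. i \<in> J \<Longrightarrow> j \<notin> J \<Longrightarrow> \<gamma> \<le> \<bar>k i - k j\<bar>"
        and R: "\<And>i j. i \<noteq> j \<Longrightarrow> (R $ i $ j)\<^sup>2 = (Q $ i $ j)\<^sup>2" for J and R :: "real ^ 'n ^ 'n"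
    proof -
      have "\<gamma>\<^sup>2 * (\<Sum>i\<in>J. \<Sum>j\<in>-J. (R $ i $ j)\<^sup>2) = (\<Sum>i\<in>J. \<Sum>j\<in>-J. \<gamma>\<^sup>2 * (Q $ i $ j)\<^sup>2)"
        unfolding sum_distrib_left by (intro sum.cong refl) (metis ComplD R)
      also have "\<dots> \<le> (\<Sum>i\<in>J. \<Sum>j\<in>-J. ((k i - k j) * Q $ i $ j)\<^sup>2)"
        unfolding power_mult_distrib
        using J \<gamma>(1) by (intro sum_mono mult_right_mono) (auto simp: abs_le_square_iff[symmetric])
      also have "\<dots> \<le> (\<Sum>i\<in>J. \<Sum>j\<in>UNIV. ((k i - k j) * Q $ i $ j)\<^sup>2)"
        by (intro sum_mono sum_mono2) auto
      also have "\<dots> \<le> ?S" by (intro sum_mono2) (auto intro: sum_nonneg)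
      finally show ?thesis .
    qed
    have "\<gamma>\<^sup>2 * ?x \<le> \<gamma>\<^sup>2 * (2 * (\<Sum>i\<in>L. \<Sum>j\<in>-L. (Q $ i $ j)\<^sup>2))"
      by (intro mult_left_mono orth_projection_small_block Q small) simp
    also have "\<dots> \<le> 2 * ?S"
      using block[of L Q] \<gamma>(2) by (fastforce simp: L_def not_less)
    finally have x: "\<gamma>\<^sup>2 * ?x \<le> 2 * ?S" .
    have "\<gamma>\<^sup>2 * ?y \<le> \<gamma>\<^sup>2 * (2 * (\<Sum>i\<in>G. \<Sum>j\<in>-G. ((mat 1 - Q) $ i $ j)\<^sup>2))"
      by (intro mult_left_mono orth_projection_small_block Q' small) simp
    also have "\<dots> \<le> 2 * ?S"
      using block[of G "mat 1 - Q"] \<gamma>(2) by (fastforce simp: G_def not_less mat_def)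
    finally have y: "\<gamma>\<^sup>2 * ?y \<le> 2 * ?S" .
    have "\<gamma>\<^sup>2 * ?d \<le> \<Gamma> * (\<gamma>\<^sup>2 * ?y + \<gamma>\<^sup>2 * ?x)"
      using mult_left_mono[OF upper, of "\<gamma>\<^sup>2"] by (simp add: algebra_simps)
    also have "\<dots> \<le> \<Gamma> * (4 * ?S)"
      using x y \<Gamma>(1) by (intro mult_left_mono) auto
    finally show "?d \<le> 4 * \<Gamma> / \<gamma>\<^sup>2 * ?S"
      using \<gamma>(1) by (simp add: field_simps)
  qed (use \<gamma> \<Gamma> in auto)
qed

section \<open>Low-rank matrices\<close>

lemma norm_matrix_vector_mult_le:
  fixes A :: "real ^ 'n ^ 'm"
  shows "norm (A *v x) \<le> norm A * norm x"
proof (rule power2_le_imp_le)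
  have "(norm (A *v x))\<^sup>2 = (\<Sum>i\<in>UNIV. (A $ i \<bullet> x)\<^sup>2)"
    unfolding power2_norm_eq_inner inner_vec_def[of "A *v x"]
    by (simp add: matrix_mult_dot power2_eq_square)
  also have "\<dots> \<le> (\<Sum>i\<in>UNIV. (norm (A $ i))\<^sup>2 * (norm x)\<^sup>2)"
    by (intro sum_mono) (metis Cauchy_Schwarz_ineq power2_norm_eq_inner)
  also have "\<dots> = (norm A * norm x)\<^sup>2"
    by (simp add: norm_matrix_power2_rows power_mult_distrib sum_distrib_right)
  finally show "(norm (A *v x))\<^sup>2 \<le> (norm A * norm x)\<^sup>2" .
qed simp

lemma norm_matrix_le_if_vector_bound:
  fixes A :: "real ^ 'n ^ 'm"
  assumes "\<And>x. norm (A *v x) \<le> c * norm x"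
  shows "(norm A)\<^sup>2 \<le> real CARD('n) * c\<^sup>2"
proof -
  have "(norm A)\<^sup>2 = (\<Sum>j\<in>UNIV. (norm (transpose A $ j))\<^sup>2)"
    using norm_matrix_power2_rows[of "transpose A"] by (simp add: norm_transpose)
  also have "\<dots> \<le> (\<Sum>j\<in>(UNIV :: 'n set). c\<^sup>2)"
  proof (rule sum_mono)
    fix j
    have "A *v axis j 1 = transpose A $ j"
      by (simp add: matrix_vector_mult_basis column_def transpose_def)
    then show "(norm (transpose A $ j))\<^sup>2 \<le> c\<^sup>2"
      using assms[of "axis j 1"] by (simp add: power_mono)
  qed
  finally show ?thesis by simp
qed

lemma matrix_mult_projection_eq_self:
  fixes A :: "real ^ 'n ^ 'm"
  assumes "transpose Q = Q" and "\<And>i. Q *v (A $ i) = A $ i"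
  shows "A ** Q = A"
proof -
  have "Q $ k $ j = Q $ j $ k" for k j
    using assms(1) unfolding transpose_def by (metis vec_lambda_beta)
  then have "(A ** Q) $ i = Q *v (A $ i)" for i
    by (simp add: vec_eq_iff matrix_matrix_mult_def matrix_vector_mult_def mult.commute)
  then show ?thesis using assms(2) by (simp add: vec_eq_iff)
qed

lemma matrix_row_in_rows: "A $ i \<in> rows A"
  by (auto simp: rows_def row_def)

text \<open>
  The rank of \<open>Q\<close> is prescribed even if the rank of \<open>A\<close> is smaller; then \<open>Q\<close> projects onto a larger
  space than the row space of \<open>A\<close>.
\<close>

lemma row_space_projection:
  fixes A :: "real ^ 'n ^ 'm"
  assumes "rank A \<le> r" "r \<le> CARD('n)"
  obtains Q where "orth_projection Q" "trace Q = real r" "A ** Q = A"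
    "rank A = r \<Longrightarrow> (\<And>x. Q *v x \<in> span (rows A))"
proof -
  obtain B where B: "B \<subseteq> rows A" "independent B" "rows A \<subseteq> span B" "card B = rank A"
    unfolding row_rank_def by (rule basis_exists[of "rows A"])
  obtain C where C: "B \<subseteq> C" "independent C" "UNIV \<subseteq> span C"
    by (rule maximal_independent_subset_extend[OF subset_UNIV B(2)]) (rule that)
  have "finite C" using C(2) independent_imp_finite by blast
  have "card C = CARD('n)"
    using C(2,3) basis_card_eq_dim[of C UNIV] by simp
  then obtain D where D: "B \<subseteq> D" "D \<subseteq> C" "card D = r"
    using exists_subset_between[of B r C] assms B(4) C(1) \<open>finite C\<close> by auto
  have dimD: "dim (span D) = r"
    using D C(2) by (simp add: dim_eq_card_independent independent_mono)
  obtain Q where Q: "orth_projection Q" "\<And>x. Q *v x \<in> span D"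
      "\<And>x. x \<in> span D \<Longrightarrow> Q *v x = x" "trace Q = real (dim (span D))"
    using orth_projection_onto_subspace[OF subspace_span] by metis
  have "A $ i \<in> span D" for i
    using matrix_row_in_rows[of A i] B(3) span_mono[OF D(1)] by blast
  then have "A ** Q = A"
    using Q by (intro matrix_mult_projection_eq_self) (auto simp: orth_projection_def)
  moreover have "Q *v x \<in> span (rows A)" if "rank A = r" for x
  proof -
    have "B = D" using D B(4) that \<open>finite C\<close> finite_subset card_subset_eq by metis
    then show ?thesis using Q(2) span_mono[OF B(1)] by blast
  qed
  ultimately show thesis using that Q(1,4) dimD by metis
qed

text \<open>
  \<open>B\<^sub>0\<close> is bounded below on its row space \<open>V\<^sub>0\<close>, and hence so is every nearby \<open>B\<close>. On the row space \<open>V\<close>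
  of \<open>B\<close> itself the same lower bound is obtained by comparison: the projection onto \<open>V\<close> does not
  change \<open>B x\<close>, so it is injective on \<open>V\<^sub>0\<close>, and as \<open>V\<close> has no larger dimension it maps \<open>V\<^sub>0\<close> onto \<open>V\<close>.
  Preimages under \<open>B\<close> can thus always be chosen in \<open>V\<^sub>0\<close>.
\<close>

lemma nearby_low_rank_bounded_right_inverse:
  fixes B\<^sub>0 :: "real ^ 'n ^ 'm"
  obtains s where "0 < s"
    "\<And>B. norm (B - B\<^sub>0) < s \<Longrightarrow> rank B \<le> rank B\<^sub>0 \<Longrightarrow>
      rank B = rank B\<^sub>0 \<and> (\<forall>x. \<exists>z. B *v z = B *v x \<and> s * norm z \<le> norm (B *v x))"
proof -
  let ?V\<^sub>0 = "span (rows B\<^sub>0)"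
  have "\<forall>x\<in>?V\<^sub>0. B\<^sub>0 *v x = 0 \<longrightarrow> x = 0"
    using matrix_vector_mul_injective_on_rowspace[of B\<^sub>0 _ 0] span_0 by auto
  then obtain e where e: "0 < e" "\<And>x. x \<in> ?V\<^sub>0 \<Longrightarrow> e * norm x \<le> norm (B\<^sub>0 *v x)"
    using injective_imp_isometric[of ?V\<^sub>0 "(*v) B\<^sub>0"] closed_subspace by auto
  show thesis
  \<comment> \<open>half of the lower bound \<open>e\<close> is spent on the perturbation\<close>
  proof (rule that[of "e / 2"])
    fix B :: "real ^ 'n ^ 'm"
    assume near: "norm (B - B\<^sub>0) < e / 2" and rk: "rank B \<le> rank B\<^sub>0"
    have low: "e / 2 * norm x \<le> norm (B *v x)" if "x \<in> ?V\<^sub>0" for x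
    proof -
      have "norm (B\<^sub>0 *v x) \<le> norm (B *v x) + norm ((B - B\<^sub>0) *v x)"
        using norm_triangle_ineq4[of "B *v x" "(B - B\<^sub>0) *v x"]
        by (simp add: matrix_vector_mult_diff_rdistrib)
      moreover have "norm ((B - B\<^sub>0) *v x) \<le> e / 2 * norm x"
        using norm_matrix_vector_mult_le[of "B - B\<^sub>0" x] near
          mult_right_mono[of "norm (B - B\<^sub>0)" "e / 2" "norm x"] by simp
      ultimately show ?thesis using e(2)[OF that] by simp
    qed
    let ?V = "span (rows B)"
    obtain Q where Q: "orth_projection Q" "\<And>x. Q *v x \<in> ?V" "\<And>x. x \<in> ?V \<Longrightarrow> Q *v x = x"
      using orth_projection_onto_subspace[OF subspace_span] by metis
    have "Q *v (B $ i) = B $ i" for i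
      by (intro Q(3) span_base matrix_row_in_rows)
    then have "B ** Q = B"
      using Q(1) by (intro matrix_mult_projection_eq_self) (auto simp: orth_projection_def)
    then have BQ: "B *v (Q *v x) = B *v x" for x by (simp add: matrix_vector_mul_assoc)
    have inj: "inj_on ((*v) Q) ?V\<^sub>0"
    proof (rule inj_onI)
      fix x y assume xy: "x \<in> ?V\<^sub>0" "y \<in> ?V\<^sub>0" "Q *v x = Q *v y"
      then have "B *v (x - y) = 0" using BQ[of x] BQ[of y] by (simp add: matrix_vector_mult_diff_distrib)
      then show "x = y" using low[of "x - y"] xy e(1) by (simp add: span_diff mult_le_0_iff)
    qed
    have dims: "dim ((*v) Q ` ?V\<^sub>0) = rank B\<^sub>0"
      using dim_image_eq[of "(*v) Q" ?V\<^sub>0] inj by (simp add: row_rank_def span_span)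
    have "(*v) Q ` ?V\<^sub>0 = ?V"
    proof (rule subspace_dim_equal)
      show "subspace ((*v) Q ` ?V\<^sub>0)" by (simp add: linear_subspace_image)
      show "dim ?V \<le> dim ((*v) Q ` ?V\<^sub>0)" using rk dims by (simp add: row_rank_def)
    qed (use Q in auto)
    moreover from this have "rank B = rank B\<^sub>0" using dims by (simp add: row_rank_def)
    moreover have "\<exists>z. B *v z = B *v x \<and> e / 2 * norm z \<le> norm (B *v x)" for x
    proof -
      obtain z where z: "z \<in> ?V\<^sub>0" "Q *v x = Q *v z" using calculation(1) Q(2)[of x] by blast
      then have "B *v z = B *v x" using BQ by metis
      then show ?thesis using low[OF z(1)] by metis
    qed
    ultimately show "rank B = rank B\<^sub>0 \<and>
        (\<forall>x. \<exists>z. B *v z = B *v x \<and> e / 2 * norm z \<le> norm (B *v x))" by blast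
  qed (use e in simp)
qed

lemma span_rows_eq_range_transpose: "span (rows A) = range ((*v) (transpose A))"
  for A :: "real ^ 'n ^ 'm"
proof
  have "rows A \<subseteq> range ((*v) (transpose A))"
  proof
    fix v assume "v \<in> rows A"
    then obtain i where "v = A $ i" by (auto simp: rows_def row_def)
    then have "v = transpose A *v axis i 1"
      by (simp add: matrix_vector_mult_basis column_def transpose_def)
    then show "v \<in> range ((*v) (transpose A))" by blast
  qed
  then show "span (rows A) \<subseteq> range ((*v) (transpose A))"
    by (intro span_minimal linear_subspace_image[OF matrix_vector_mul_linear subspace_UNIV])
  show "range ((*v) (transpose A)) \<subseteq> span (rows A)"
    using matrix_vector_mult_in_columnspace[of "transpose A"] by (auto simp: columns_transpose)
qed

lemma rank_add_le:
  fixes A B :: "real ^ 'n ^ 'm"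
  shows "rank (A + B) \<le> rank A + rank B"
proof -
  let ?S = "range ((*v) A)" and ?T = "range ((*v) B)"
  have "range ((*v) (A + B)) \<subseteq> {x + y | x y. x \<in> ?S \<and> y \<in> ?T}"
    by (auto simp: matrix_vector_mult_add_rdistrib)
  then have "rank (A + B) \<le> dim {x + y | x y. x \<in> ?S \<and> y \<in> ?T}"
    by (simp add: rank_dim_range dim_subset)
  also have "\<dots> \<le> dim ?S + dim ?T"
    using dim_sums_Int[of ?S ?T] by (simp add: linear_subspace_image)
  finally show ?thesis by (simp add: rank_dim_range)
qed

lemma rank_single_entry_le:
  "rank (\<chi> a b. if a = i \<and> b = j then c else 0 :: real ^ 'n ^ 'm) \<le> 1" for c :: real
proof -
  let ?A = "\<chi> a b. if a = i \<and> b = j then c else 0 :: real ^ 'n ^ 'm"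
  have "rows ?A \<subseteq> span {axis j 1}"
  proof
    fix v assume "v \<in> rows ?A"
    then have "v = v $ j *\<^sub>R axis j 1"
      by (auto simp: rows_def row_def vec_eq_iff axis_def)
    then show "v \<in> span {axis j 1}" by (metis span_base span_scale singletonI)
  qed
  then have "dim (rows ?A) \<le> card {axis j 1 :: real ^ 'n}" by (intro dim_le_card) auto
  then show ?thesis by (simp add: row_rank_def)
qed

lemma inner_single_entry:
  fixes A :: "real ^ 'n ^ 'm"
  shows "A \<bullet> (\<chi> a b. if a = i \<and> b = j then c else 0) = c * A $ i $ j"
proof -
  have "A $ a $ b * (if a = i \<and> b = j then c else 0) = (if b = j then (if a = i then c * A $ a $ b else 0) else 0)"
    for a b by simp
  then show ?thesis by (simp add: inner_vec_def)
qed

text \<open>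
  With rank to spare, changing a single entry of \<open>A\<close> to the corresponding entry of \<open>M\<close> keeps the
  rank admissible and brings \<open>A\<close> closer to \<open>M\<close>.
\<close>

lemma best_approximation_has_full_rank:
  fixes A M :: "real ^ 'n ^ 'm"
  assumes "rank A \<le> r" "r \<le> rank M"
    and min: "\<And>B :: real ^ 'n ^ 'm. rank B \<le> r \<Longrightarrow> norm (A - M) \<le> norm (B - M)"
  shows "rank A = r"
proof (rule ccontr)
  assume ne: "rank A \<noteq> r"
  then have "A \<noteq> M" using assms by auto
  then obtain i j where ij: "(A - M) $ i $ j \<noteq> 0" by (auto simp: vec_eq_iff)
  let ?R = "\<chi> a b. if a = i \<and> b = j then - (A - M) $ i $ j else 0 :: real ^ 'n ^ 'm"
  have "rank (A + ?R) \<le> rank A + 1"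
    using rank_add_le[of A ?R] rank_single_entry_le[where 'n='n and 'm='m, of i j "- (A - M) $ i $ j"] by linarith
  then have "norm (A - M) \<le> norm (A + ?R - M)" using ne assms(1) by (intro min) auto
  then have "(norm (A - M))\<^sup>2 \<le> (norm (A + ?R - M))\<^sup>2" by (simp add: power_mono)
  moreover have "(norm (A + ?R - M))\<^sup>2 = (norm (A - M))\<^sup>2 + 2 * ((A - M) \<bullet> ?R) + (norm ?R)\<^sup>2"
    unfolding power2_norm_eq_inner by (simp add: inner_simps inner_commute)
  moreover have "(A - M) \<bullet> ?R = - (((A - M) $ i $ j)\<^sup>2)" "(norm ?R)\<^sup>2 = ((A - M) $ i $ j)\<^sup>2"
    by (simp_all only: power2_norm_eq_inner inner_single_entry) (simp_all add: power2_eq_square algebra_simps)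
  ultimately show False using ij by simp
qed

text \<open>
  The columns of \<open>X\<close> enumerate a basis of the column space; \<open>inv_into\<close> may fill the remaining
  columns arbitrarily, since \<open>Y\<close> need not use them.
\<close>

lemma low_rank_factorization:
  fixes A :: "real ^ 'n ^ 'm"
  assumes "rank A \<le> CARD('r)"
  obtains X :: "real ^ 'r ^ 'm" and Y :: "real ^ 'n ^ 'r" where "A = X ** Y"
proof -
  obtain B where B: "B \<subseteq> columns A" "independent B" "columns A \<subseteq> span B" "card B = rank A"
    unfolding column_rank_def by (rule basis_exists[of "columns A"])
  have "finite B" using B(2) independent_imp_finite by blast
  then obtain g :: "real ^ 'm \<Rightarrow> 'r" where g: "inj_on g B"
    using card_le_inj[of B "UNIV :: 'r set"] assms B(4) by auto
  define X :: "real ^ 'r ^ 'm" where "X = (\<chi> i c. inv_into B g c $ i)"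
  have "B \<subseteq> range ((*v) X)"
  proof
    fix b assume "b \<in> B"
    then have "b = X *v axis (g b) 1"
      using g by (simp add: matrix_vector_mult_basis column_def X_def vec_eq_iff)
    then show "b \<in> range ((*v) X)" by blast
  qed
  then have "columns A \<subseteq> range ((*v) X)"
    using B(3) span_minimal[OF _ linear_subspace_image[OF matrix_vector_mul_linear subspace_UNIV]]
    by blast
  then have "\<forall>j. \<exists>y. column j A = X *v y" by (auto simp: columns_def)
  then obtain y where y: "\<And>j. column j A = X *v y j" by metis
  have "A = X ** (\<chi> c j. y j $ c)"
    using y by (simp add: vec_eq_iff column_def matrix_matrix_mult_def matrix_vector_mult_def)
  then show thesis by (rule that)
qed

lemma filter_mset_replicate_mset: "filter_mset P (replicate_mset n x) = (if P x then replicate_mset n x else {#})"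
  by (induction n) auto

text \<open>
  A positive entry at position \<open>r\<close> of the decreasing list of eigenvalues means that the eigenspaces
  of positive eigenvalues have total dimension at least \<open>r\<close>. These eigenspaces are mutually
  orthogonal and contained in the range of \<open>K\<close>.
\<close>

lemma rank_ge_if_eigval_pos:
  fixes K :: "real ^ 'n ^ 'n"
  assumes sym: "transpose K = K" and pos: "0 < eigval K r"
  shows "r \<le> rank K"
proof -
  let ?l = "eigvals_desc K"
  let ?T = "{t \<in> eigenvalues K. 0 < t}"
  define m where "m = (\<Sum>t\<in>eigenvalues K. replicate_mset (dim (eigenspace K t)) t)"
  have r: "1 \<le> r" "r \<le> length ?l" "0 < ?l ! (r - 1)"
    using pos by (auto simp: eigval_def split: if_splits)
  have desc: "sorted (rev ?l)" and mset: "mset ?l = m"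
    by (simp_all add: eigvals_desc_def m_def)
  have first_pos: "0 < ?l ! i" if "i < r" for i
  proof -
    have "?l ! (r - 1) \<le> ?l ! i"
      using sorted_rev_nth_mono[OF desc, of i "r - 1"] that r by simp
    then show ?thesis using r(3) by linarith
  qed
  then have "\<forall>x\<in>set (take r ?l). 0 < x"
    using r by (auto simp: in_set_conv_nth)
  then have "r \<le> length (filter (\<lambda>t. 0 < t) ?l)"
    using length_filter_le r
    by (subst append_take_drop_id[of r ?l, symmetric], subst filter_append) (simp add: filter_id_conv[THEN iffD2])
  also have "\<dots> = size (filter_mset (\<lambda>t. 0 < t) m)"
    by (simp add: mset[symmetric] flip: size_mset)
  also have "\<dots> = (\<Sum>t\<in>eigenvalues K. if 0 < t then dim (eigenspace K t) else 0)"
    unfolding m_def using finite_eigenvalues[OF sym]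
    by (induction rule: finite_induct) (auto simp: filter_mset_replicate_mset)
  also have "\<dots> = (\<Sum>t\<in>?T. dim (eigenspace K t))"
    using finite_eigenvalues[OF sym] by (simp add: sum.inter_filter)
  also have "\<dots> \<le> rank K"
  proof -
    have "subspace (eigenspace K t)" for t
      by (auto simp: subspace_def eigenspace_def algebra_simps)
    then have "\<forall>t. \<exists>B. B \<subseteq> eigenspace K t \<and> pairwise orthogonal B \<and> 0 \<notin> B \<and> independent B \<and>
        card B = dim (eigenspace K t)"
      by (metis orthogonal_basis_subspace)
    then obtain B where B: "\<And>t. B t \<subseteq> eigenspace K t" "\<And>t. pairwise orthogonal (B t)" "\<And>t. 0 \<notin> B t"
      "\<And>t. independent (B t)" "\<And>t. card (B t) = dim (eigenspace K t)" by metis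
    have orth: "x \<bullet> y = 0" if "x \<in> eigenspace K s" "y \<in> eigenspace K t" "s \<noteq> t" for s t x y
      using symmetric_matrix_inner[OF sym, of x y] that by (auto simp: eigenspace_def)
    have "pairwise orthogonal (\<Union>t\<in>?T. B t)"
      unfolding pairwise_def orthogonal_def
    proof (intro ballI impI)
      fix x y assume "x \<in> (\<Union>t\<in>?T. B t)" "y \<in> (\<Union>t\<in>?T. B t)" "x \<noteq> y"
      then obtain s t where "x \<in> B s" "y \<in> B t" by blast
      then show "x \<bullet> y = 0"
        using orth[of x s y t] B(1)[of s] B(1)[of t] B(2)[of s] \<open>x \<noteq> y\<close>
        by (cases "s = t") (auto simp: pairwise_def orthogonal_def)
    qed
    moreover have "0 \<notin> (\<Union>t\<in>?T. B t)" using B(3) by blast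
    ultimately have "independent (\<Union>t\<in>?T. B t)" by (rule pairwise_orthogonal_independent)
    moreover have "(\<Union>t\<in>?T. B t) \<subseteq> range ((*v) K)"
    proof
      fix x assume "x \<in> (\<Union>t\<in>?T. B t)"
      then obtain t where t: "0 < t" "K *v x = t *\<^sub>R x" using B(1) by (auto simp: eigenspace_def)
      then have "x = K *v (x /\<^sub>R t)" by (simp add: matrix_vector_mult_scaleR)
      then show "x \<in> range ((*v) K)" by blast
    qed
    ultimately have "card (\<Union>t\<in>?T. B t) \<le> rank K"
      unfolding rank_dim_range by (simp add: independent_card_le_dim)
    moreover have "card (\<Union>t\<in>?T. B t) = (\<Sum>t\<in>?T. card (B t))"
    proof (rule card_UN_disjoint)
      show "\<forall>s\<in>?T. \<forall>t\<in>?T. s \<noteq> t \<longrightarrow> B s \<inter> B t = {}"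
      proof (intro ballI impI)
        fix s t :: real assume "s \<noteq> t"
        have "x \<notin> B t" if x: "x \<in> B s" for x
        proof
          assume "x \<in> B t"
          then have "x \<bullet> x = 0" using orth[of x s x t] B(1) x \<open>s \<noteq> t\<close> by blast
          then show False using x B(3) by simp
        qed
        then show "B s \<inter> B t = {}" by blast
      qed
      show "\<forall>t\<in>?T. finite (B t)" using B(4) independent_imp_finite by blast
    qed (simp add: finite_eigenvalues[OF sym])
    ultimately show ?thesis by (simp add: B(5))
  qed
  finally show ?thesis .
qed

lemma rank_ge_if_singval_pos:
  fixes M :: "real ^ 'n ^ 'm"
  assumes "0 < singval M r"
  shows "r \<le> rank M"
proof -
  have "r \<le> rank (transpose M ** M)"
    using assms by (intro rank_ge_if_eigval_pos) (auto simp: singval_def matrix_transpose_mul)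
  also have "\<dots> \<le> rank M" by (rule rank_mul_le_right)
  finally show ?thesis .
qed

section \<open>Best low-rank approximation\<close>

definition diag_matrix :: "('n \<Rightarrow> real) \<Rightarrow> real ^ 'n ^ 'n" where
  "diag_matrix k = (\<chi> i j. if i = j then k i else 0)"

lemma diag_matrix_mult_nth: "(diag_matrix k ** A) $ i $ j = k i * A $ i $ j"
  for A :: "real ^ 'p ^ 'n::finite"
proof -
  have "(if i = l then k i else 0) * A $ l $ j = (if l = i then k i * A $ i $ j else 0)" for l
    by simp
  then show ?thesis by (simp add: diag_matrix_def matrix_matrix_mult_def)
qed

lemma mult_diag_matrix_nth: "(A ** diag_matrix k) $ i $ j = A $ i $ j * k j"
  for A :: "real ^ 'n::finite ^ 'm"
proof -
  have "A $ i $ l * (if l = j then k l else 0) = (if l = j then A $ i $ j * k j else 0)" for l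
    by simp
  then show ?thesis by (simp add: diag_matrix_def matrix_matrix_mult_def)
qed

lemma inner_diag_matrix: "Q \<bullet> diag_matrix k = (\<Sum>i\<in>UNIV. k i * Q $ i $ i)"
  for Q :: "real ^ 'n::finite ^ 'n"
proof -
  have "Q $ i $ j * (if i = j then k i else 0) = (if j = i then k i * Q $ i $ i else 0)" for i j
    by simp
  then show ?thesis by (simp add: inner_vec_def diag_matrix_def)
qed

lemma orth_projection_indicator:
  "orth_projection (diag_matrix (\<lambda>i. if i \<in> I then 1 else 0) :: real ^ 'n::finite ^ 'n)"
proof -
  let ?D = "diag_matrix (\<lambda>i. if i \<in> I then 1 else 0) :: real ^ 'n ^ 'n"
  have "(?D ** ?D) $ i $ j = ?D $ i $ j" for i j
    unfolding diag_matrix_mult_nth by (simp add: diag_matrix_def)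
  then show ?thesis
    by (auto simp: orth_projection_def vec_eq_iff transpose_def) (auto simp: diag_matrix_def)
qed

lemma rank_mult_indicator_le:
  fixes M :: "real ^ 'n ^ 'm"
  shows "rank (M ** diag_matrix (\<lambda>i. if i \<in> I then 1 else 0)) \<le> card I"
proof -
  let ?D = "diag_matrix (\<lambda>i. if i \<in> I then 1 else 0) :: real ^ 'n ^ 'n"
  have "rows ?D \<subseteq> span ((\<lambda>i. axis i 1) ` I)"
  proof
    fix v assume "v \<in> rows ?D"
    then obtain i where "v = ?D $ i" by (auto simp: rows_def row_def)
    moreover have "?D $ i = (if i \<in> I then axis i 1 else 0)"
      by (simp add: diag_matrix_def vec_eq_iff axis_def)
    ultimately show "v \<in> span ((\<lambda>i. axis i 1) ` I)" by (auto intro: span_base span_zero)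
  qed
  then have "dim (rows ?D) \<le> card ((\<lambda>i. axis i (1::real)) ` I)" by (intro dim_le_card) auto
  also have "\<dots> \<le> card I" by (rule card_image_le) simp
  finally have "rank ?D \<le> card I" by (simp add: row_rank_def)
  then show ?thesis using rank_mul_le_right[of M ?D] by simp
qed

lemma top_index_set:
  fixes k :: "'n::finite \<Rightarrow> real"
  assumes "r \<le> CARD('n)"
  obtains I t where "card I = r" "\<And>i. i \<in> I \<Longrightarrow> t \<le> k i" "\<And>i. i \<notin> I \<Longrightarrow> k i \<le> t"
proof -
  have "\<exists>I t. card I = r \<and> (\<forall>i\<in>I. t \<le> k i) \<and> (\<forall>i. i \<notin> I \<longrightarrow> k i \<le> t)"
    using assms
  proof (induction r)
    case 0
    then show ?case by (intro exI[of _ "{}"] exI[of _ "Max (range k)"]) auto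
  next
    case (Suc r)
    then obtain I t where I: "card I = r" "\<forall>i\<in>I. t \<le> k i" "\<forall>i. i \<notin> I \<longrightarrow> k i \<le> t" by auto
    have "I \<noteq> UNIV" using I(1) Suc.prems by auto
    then have "- I \<noteq> {}" by blast
    then have "Max (k ` (- I)) \<in> k ` (- I)" by (intro Max_in) auto
    then obtain a where a: "a \<in> - I" "Max (k ` (- I)) = k a" by (elim imageE)
    have "k i \<le> k a" if "i \<notin> I" for i
      unfolding a(2)[symmetric] using that by (intro Max_ge) auto
    moreover have "k a \<le> k i" if "i \<in> I" for i using that I a(1) by force
    ultimately show ?case
      using I(1) a(1) by (intro exI[of _ "insert a I"] exI[of _ "k a"]) auto
  qed
  then show thesis using that by blast
qed

text \<open>
  Since \<open>A (1 - Q) = 0\<close>, the part of \<open>A - M\<close> beyond \<open>Q\<close> is that of \<open>M\<close> alone and depends on \<open>A\<close> only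
  through \<open>Q\<close>.
\<close>

lemma low_rank_objective_split:
  fixes A M :: "real ^ 'n ^ 'm"
  assumes gram: "transpose M ** M = diag_matrix k" and Q: "orth_projection Q" and AQ: "A ** Q = A"
  shows "(norm (A - M))\<^sup>2 =
    (norm ((A - M) ** Q))\<^sup>2 + (norm M)\<^sup>2 - (\<Sum>i\<in>UNIV. k i * Q $ i $ i)"
proof -
  have "(A - M) ** (mat 1 - Q) = - (M ** (mat 1 - Q))"
    using AQ by (simp add: matrix_mult.diff_right matrix_mult.diff_left)
  then have "(norm (A - M))\<^sup>2 = (norm ((A - M) ** Q))\<^sup>2 + (norm (M ** (mat 1 - Q)))\<^sup>2"
    using norm_orth_projection_split[OF Q, of "A - M"] by simp
  moreover have "(norm (M ** Q))\<^sup>2 = (\<Sum>i\<in>UNIV. k i * Q $ i $ i)"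
  proof -
    have "(norm (M ** Q))\<^sup>2 = (transpose M ** (M ** Q)) \<bullet> Q"
      unfolding power2_norm_eq_inner by (rule inner_matrix_mult_left)
    also have "\<dots> = Q \<bullet> (diag_matrix k ** Q)"
      by (simp add: matrix_mul_assoc gram inner_commute)
    also have "\<dots> = (Q ** transpose Q) \<bullet> diag_matrix k" by (rule inner_matrix_mult_right)
    finally show ?thesis using Q by (simp add: orth_projection_def inner_diag_matrix)
  qed
  ultimately show ?thesis using norm_orth_projection_split[OF Q, of M] by simp
qed

text \<open>
  The lower half of the Eckart-Young theorem: the trace of \<open>K Q\<close> is at most the sum of the largest
  eigenvalues.
\<close>

lemma low_rank_objective_ge:
  fixes A M :: "real ^ 'n ^ 'm"
  assumes gram: "transpose M ** M = diag_matrix k"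
    and up: "\<And>i. i \<in> I \<Longrightarrow> t \<le> k i" and lo: "\<And>i. i \<notin> I \<Longrightarrow> k i \<le> t"
    and rk: "rank A \<le> card I"
  shows "(norm M)\<^sup>2 - (\<Sum>i\<in>I. k i) \<le> (norm (A - M))\<^sup>2"
proof -
  have "card I \<le> CARD('n)" by (simp add: card_mono)
  then obtain Q where Q: "orth_projection Q" "trace Q = real (card I)" "A ** Q = A"
    using row_space_projection[OF rk] by metis
  have "(\<Sum>i\<in>I. k i) - (\<Sum>i\<in>UNIV. k i * Q $ i $ i) =
      (\<Sum>i\<in>UNIV. \<bar>k i - t\<bar> * (if i \<in> I then 1 - Q $ i $ i else Q $ i $ i))"
    by (rule trace_gap_eq[OF Q(2) up lo])
  also have "\<dots> \<ge> 0"
    using orth_projection_diag_nonneg[OF Q(1)] orth_projection_diag_le_1[OF Q(1)]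
    by (intro sum_nonneg) simp
  finally have "0 \<le> (\<Sum>i\<in>I. k i) - (\<Sum>i\<in>UNIV. k i * Q $ i $ i)" .
  then show ?thesis
    using low_rank_objective_split[OF gram Q(1,3)] zero_le_power2[of "norm ((A - M) ** Q)"]
    by linarith
qed

text \<open>
  If \<open>I\<close> selects the largest eigenvalues, then the lower bound is attained by truncation.
\<close>

lemma low_rank_objective_truncation:
  fixes M :: "real ^ 'n ^ 'm"
  assumes gram: "transpose M ** M = diag_matrix k"
  shows "(norm (M ** diag_matrix (\<lambda>i. if i \<in> I then 1 else 0) - M))\<^sup>2 = (norm M)\<^sup>2 - (\<Sum>i\<in>I. k i)"
proof -
  let ?D = "diag_matrix (\<lambda>i. if i \<in> I then 1 else 0) :: real ^ 'n ^ 'n"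
  note D = orth_projection_indicator[of I]
  then have MDD: "(M ** ?D) ** ?D = M ** ?D"
    by (simp add: orth_projection_def matrix_mul_assoc[symmetric])
  have "(\<Sum>i\<in>UNIV. k i * ?D $ i $ i) = (\<Sum>i\<in>I. k i)"
    by (intro sum.mono_neutral_cong_right) (auto simp: diag_matrix_def)
  then show ?thesis
    using low_rank_objective_split[OF gram D MDD] by (simp add: matrix_mult.diff_left MDD)
qed

lemma norm_mult_orthogonal_matrix:
  fixes A :: "real ^ 'n ^ 'm"
  assumes "orthogonal_matrix U"
  shows "norm (A ** U) = norm A"
proof -
  have "(A ** U) \<bullet> (A ** U) = ((A ** U) ** transpose U) \<bullet> A" by (rule inner_matrix_mult_right)
  also have "(A ** U) ** transpose U = A"
    using assms by (simp add: matrix_mul_assoc[symmetric] orthogonal_matrix_def)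
  finally show ?thesis by (simp add: norm_eq_sqrt_inner)
qed

text \<open>
  Multiplying \<open>A\<close> and \<open>M\<close> by \<open>U\<^sup>T\<close> from the right preserves norms, ranks and residual norms, so that
  the Gram matrix of \<open>M\<close> may be taken diagonal.
\<close>

lemma gram_matrix_in_eigenbasis:
  fixes M :: "real ^ 'n ^ 'm"
  assumes U: "orthogonal_matrix U" and k: "\<And>i. (transpose M ** M) *v (U $ i) = k i *\<^sub>R U $ i"
  shows "transpose (M ** transpose U) ** (M ** transpose U) = diag_matrix k"
proof -
  have on: "U $ i \<bullet> U $ j = (if i = j then 1 else 0)" for i j
    using U unfolding orthogonal_matrix_orthonormal_rows row_def
    by (auto simp: orthogonal_def norm_eq_1)
  let ?K = "transpose M ** M"
  have "(U ** (?K ** transpose U)) $ i $ j = U $ i \<bullet> (?K *v (U $ j))" for i j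
    unfolding matrix_matrix_mult_def[of U] matrix_matrix_mult_def[of ?K]
    by (simp add: inner_vec_def matrix_vector_mult_def transpose_def)
  also have "U $ i \<bullet> (?K *v (U $ j)) = diag_matrix k $ i $ j" for i j
    by (simp add: k on diag_matrix_def)
  finally have "U ** (?K ** transpose U) = diag_matrix k" by (simp add: vec_eq_iff)
  then show ?thesis by (simp add: matrix_transpose_mul matrix_mul_assoc)
qed

text \<open>
  The eigenbasis of \<open>M\<close> also diagonalizes \<open>M\<^sup>T M = M\<^sup>2\<close>, so truncating \<open>M\<close> to the eigenvectors in \<open>I\<close>
  gives a best approximation among all matrices, symmetric or not. As the eigenvalues are
  nonnegative, the truncation splits as \<open>X X\<^sup>T\<close> with columns \<open>sqrt (k i) u\<^sub>i\<close>.
\<close>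

lemma psd_best_approximation_is_square:
  fixes M :: "real ^ 'n ^ 'n"
  assumes M: "M \<in> psd_matrices" and r: "CARD('r) \<le> CARD('n)"
  obtains X :: "real ^ 'r ^ 'n" where
    "\<And>A :: real ^ 'n ^ 'n. rank A \<le> CARD('r) \<Longrightarrow> norm (X ** transpose X - M) \<le> norm (A - M)"
proof -
  have sym: "transpose M = M" using M by (simp add: psd_matrices_def sym_matrices_def)
  obtain U k where U: "orthogonal_matrix U" and k: "\<And>i. M *v (U $ i) = k i *\<^sub>R U $ i"
    using symmetric_matrix_diagonalization[OF sym] by metis
  have "U $ i \<bullet> U $ i = 1" for i
    using U unfolding orthogonal_matrix_orthonormal_rows row_def by (simp add: norm_eq_1)
  moreover have "0 \<le> U $ i \<bullet> (M *v (U $ i))" for i using M by (simp add: psd_matrices_def)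
  ultimately have nonneg: "0 \<le> k i" for i by (simp add: k)
  let ?M' = "M ** transpose U"
  have "(transpose M ** M) *v (U $ i) = (k i)\<^sup>2 *\<^sub>R U $ i" for i
    by (simp add: sym matrix_vector_mul_assoc[symmetric] k matrix_vector_mult_scaleR power2_eq_square)
  then have gram: "transpose ?M' ** ?M' = diag_matrix (\<lambda>i. (k i)\<^sup>2)"
    by (rule gram_matrix_in_eigenbasis[OF U])
  obtain I t where I: "card I = CARD('r)" "\<And>i. i \<in> I \<Longrightarrow> t \<le> (k i)\<^sup>2" "\<And>i. i \<notin> I \<Longrightarrow> (k i)\<^sup>2 \<le> t"
    by (rule top_index_set[OF r, of "\<lambda>i. (k i)\<^sup>2"]) (rule that)
  let ?D = "diag_matrix (\<lambda>i. if i \<in> I then 1 else 0) :: real ^ 'n ^ 'n"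
  obtain g :: "'r \<Rightarrow> 'n" where g: "bij_betw g UNIV I"
    using finite_same_card_bij[of "UNIV :: 'r set" I] I(1) by auto
  define X :: "real ^ 'r ^ 'n" where "X = (\<chi> a c. sqrt (k (g c)) * U $ g c $ a)"
  have "(X ** transpose X) $ a $ b = (?M' ** ?D ** U) $ a $ b" for a b
  proof -
    have "?M' $ a $ i = k i * U $ i $ a" for i
    proof -
      have "?M' $ a $ i = (M *v (U $ i)) $ a"
        by (simp add: matrix_matrix_mult_def matrix_vector_mult_def transpose_def)
      then show ?thesis by (simp add: k)
    qed
    then have "(?M' ** ?D ** U) $ a $ b = (\<Sum>i\<in>UNIV. (k i * U $ i $ a * (if i \<in> I then 1 else 0)) * U $ i $ b)"
      unfolding matrix_matrix_mult_def[of "?M' ** ?D"] by (simp add: mult_diag_matrix_nth)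
    also have "\<dots> = (\<Sum>i\<in>I. k i * U $ i $ a * U $ i $ b)"
      by (intro sum.mono_neutral_cong_right) auto
    also have "\<dots> = (\<Sum>c\<in>UNIV. k (g c) * U $ g c $ a * U $ g c $ b)"
      by (rule sum.reindex_bij_betw[OF g, symmetric])
    also have "\<dots> = (\<Sum>c\<in>UNIV. (sqrt (k (g c)) * U $ g c $ a) * (sqrt (k (g c)) * U $ g c $ b))"
    proof (intro sum.cong refl)
      fix c
      have "(sqrt (k (g c)) * U $ g c $ a) * (sqrt (k (g c)) * U $ g c $ b) =
          (sqrt (k (g c)) * sqrt (k (g c))) * (U $ g c $ a * U $ g c $ b)" by (simp only: mult_ac)
      then show "k (g c) * U $ g c $ a * U $ g c $ b =
          (sqrt (k (g c)) * U $ g c $ a) * (sqrt (k (g c)) * U $ g c $ b)"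
        using nonneg[of "g c"] by simp
    qed
    also have "\<dots> = (X ** transpose X) $ a $ b"
      by (simp add: X_def matrix_matrix_mult_def transpose_def)
    finally show ?thesis by simp
  qed
  then have XX: "X ** transpose X = ?M' ** ?D ** U" by (simp add: vec_eq_iff)
  have UU: "transpose U ** U = mat 1" using U by (simp add: orthogonal_matrix_def)
  have M_eq: "M = ?M' ** U" by (simp add: matrix_mul_assoc[symmetric] UU)
  show thesis
  proof (rule that[of X])
    fix A :: "real ^ 'n ^ 'n" assume "rank A \<le> CARD('r)"
    have "norm (X ** transpose X - M) = norm ((?M' ** ?D - ?M') ** U)"
      unfolding XX by (subst (2) M_eq) (simp add: matrix_mult.diff_left)
    also have "\<dots> = norm (?M' ** ?D - ?M')" by (rule norm_mult_orthogonal_matrix[OF U])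
    also have "\<dots> \<le> norm (A ** transpose U - ?M')"
    proof (rule power2_le_imp_le)
      have "rank (A ** transpose U) \<le> card I"
        using rank_mul_le_left[of A "transpose U"] \<open>rank A \<le> CARD('r)\<close> I(1) by simp
      from low_rank_objective_ge[OF gram I(2,3) this]
      show "(norm (?M' ** ?D - ?M'))\<^sup>2 \<le> (norm (A ** transpose U - ?M'))\<^sup>2"
        unfolding low_rank_objective_truncation[OF gram] by simp
    qed simp
    also have "\<dots> = norm ((A - M) ** transpose U)" by (simp add: matrix_mult.diff_left)
    also have "\<dots> = norm (A - M)" using U by (intro norm_mult_orthogonal_matrix) simp
    finally show "norm (X ** transpose X - M) \<le> norm (A - M)" .
  qed
qed

section \<open>The error bound\<close>

text \<open>
  With \<open>E = A - M\<close> and \<open>P = 1 - Q\<close>, the excess is \<open>|E Q|\<^sup>2 + d\<close> with the trace gap \<open>d\<close>. Every vector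
  in the range of \<open>Q\<close> is \<open>A\<^sup>T z\<close> with a bound on \<open>z\<close>, which controls \<open>E Q\<close> by \<open>E A\<^sup>T\<close>. The gap is
  controlled by the commutator, whose two halves are \<open>Q K P\<close> and its transpose. From
  \<open>Q M\<^sup>T = A\<^sup>T - (E Q)\<^sup>T\<close> and \<open>A\<^sup>T M P = - A\<^sup>T E P\<close>, which holds because \<open>A P = 0\<close>, one gets
  \<open>Q K P = - A\<^sup>T E P - (E Q)\<^sup>T M P\<close>.
\<close>

lemma low_rank_error_bound_diagonal:
  fixes A\<^sub>0 M :: "real ^ 'n ^ 'm"
  assumes gram: "transpose M ** M = diag_matrix k"
    and up: "\<And>i. i \<in> I \<Longrightarrow> t \<le> k i" and lo: "\<And>i. i \<notin> I \<Longrightarrow> k i \<le> t"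
    and rank0: "rank A\<^sub>0 = card I"
  obtains \<rho> l C where "0 < \<rho>" "0 < l" "0 < C"
    "\<And>A. rank A \<le> card I \<Longrightarrow> norm (A - A\<^sub>0) < \<rho> \<Longrightarrow>
      (norm (A - M))\<^sup>2 - ((norm M)\<^sup>2 - (\<Sum>i\<in>I. k i)) < l \<Longrightarrow>
      (norm (A - M))\<^sup>2 - ((norm M)\<^sup>2 - (\<Sum>i\<in>I. k i))
        \<le> C * ((norm ((A - M) ** transpose A))\<^sup>2 + (norm (transpose A ** (A - M)))\<^sup>2)"
proof -
  have cardI: "card I \<le> CARD('n)" by (simp add: card_mono)
  obtain s where s: "0 < s"
    and inv: "\<And>B. norm (B - transpose A\<^sub>0) < s \<Longrightarrow> rank B \<le> rank (transpose A\<^sub>0) \<Longrightarrow>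
      rank B = rank (transpose A\<^sub>0) \<and> (\<forall>x. \<exists>z. B *v z = B *v x \<and> s * norm z \<le> norm (B *v x))"
    by (rule nearby_low_rank_bounded_right_inverse[of "transpose A\<^sub>0"]) (rule that)
  obtain l C\<^sub>1 where l: "0 < l" and C\<^sub>1: "0 < C\<^sub>1"
    and gap: "\<And>Q :: real ^ 'n ^ 'n. orth_projection Q \<Longrightarrow> trace Q = real (card I) \<Longrightarrow>
      (\<Sum>i\<in>I. k i) - (\<Sum>i\<in>UNIV. k i * Q $ i $ i) < l \<Longrightarrow>
      (\<Sum>i\<in>I. k i) - (\<Sum>i\<in>UNIV. k i * Q $ i $ i)
        \<le> C\<^sub>1 * (\<Sum>i\<in>UNIV. \<Sum>j\<in>UNIV. ((k i - k j) * Q $ i $ j)\<^sup>2)"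
    by (rule trace_gap_le_commutator[where I = I and t = t and k = k, OF up lo]) (assumption+, rule that)
  define C\<^sub>2 where "C\<^sub>2 = real CARD('n) / s\<^sup>2"
  have "0 < C\<^sub>2" using s by (simp add: C\<^sub>2_def)
  define m where "m = (norm M)\<^sup>2"
  have m: "0 \<le> m" by (simp add: m_def)
  show thesis
  \<comment> \<open>\<open>C\<^sub>2\<close> bounds \<open>|E Q|\<^sup>2\<close>; the gap adds \<open>C\<^sub>1\<close> times \<open>4 |Q K P|\<^sup>2\<close>, where \<open>|Q K P|\<^sup>2\<close> is at most
    \<open>2 |A\<^sup>T E|\<^sup>2 + 2 m |E Q|\<^sup>2\<close>\<close>
  proof (rule that[OF s l, of "C\<^sub>2 + 8 * C\<^sub>1 + 8 * C\<^sub>1 * m * C\<^sub>2"])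
    show "0 < C\<^sub>2 + 8 * C\<^sub>1 + 8 * C\<^sub>1 * m * C\<^sub>2"
      using \<open>0 < C\<^sub>2\<close> C\<^sub>1 m by (intro add_pos_nonneg) auto
    fix A :: "real ^ 'n ^ 'm"
    assume rk: "rank A \<le> card I" and near: "norm (A - A\<^sub>0) < s"
      and small: "(norm (A - M))\<^sup>2 - ((norm M)\<^sup>2 - (\<Sum>i\<in>I. k i)) < l"
    let ?E = "A - M"
    let ?R = "norm (?E ** transpose A)" and ?S = "norm (transpose A ** ?E)"
    have "norm (transpose A - transpose A\<^sub>0) < s"
      using near by (simp add: norm_transpose flip: transpose_diff)
    from inv[OF this] have rkA: "rank A = card I"
      and rinv: "\<And>x. \<exists>z. transpose A *v z = transpose A *v x \<and> s * norm z \<le> norm (transpose A *v x)"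
      using rk rank0 by (simp_all only: rank_transpose)
    obtain Q where Q: "orth_projection Q" "trace Q = real (card I)" "A ** Q = A"
      "\<And>x. Q *v x \<in> span (rows A)"
      using row_space_projection[OF rk cardI] rkA by metis
    define d where "d = (\<Sum>i\<in>I. k i) - (\<Sum>i\<in>UNIV. k i * Q $ i $ i)"
    have objective: "(norm ?E)\<^sup>2 - ((norm M)\<^sup>2 - (\<Sum>i\<in>I. k i)) = (norm (?E ** Q))\<^sup>2 + d"
      using low_rank_objective_split[OF gram Q(1,3)] by (simp add: d_def)
    have "(norm (?E ** Q))\<^sup>2 \<le> real CARD('n) * (?R / s)\<^sup>2"
    proof (rule norm_matrix_le_if_vector_bound)
      fix x
      obtain y where "Q *v x = transpose A *v y"
        using Q(4)[of x] unfolding span_rows_eq_range_transpose by blast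
      then obtain z where z: "transpose A *v z = Q *v x" "s * norm z \<le> norm (Q *v x)"
        using rinv[of y] by auto
      have "(norm (Q *v x))\<^sup>2 = x \<bullet> (Q *v (Q *v x))"
        using Q(1) unfolding power2_norm_eq_inner
        by (intro symmetric_matrix_inner) (simp add: orth_projection_def)
      also have "\<dots> = x \<bullet> (Q *v x)" using Q(1) by (simp add: matrix_vector_mul_assoc orth_projection_def)
      also have "\<dots> \<le> norm x * norm (Q *v x)" by (rule norm_cauchy_schwarz)
      finally have "norm (Q *v x) \<le> norm x"
        by (cases "Q *v x = 0") (simp_all add: power2_eq_square)
      then have "norm z \<le> norm x / s" using z(2) s by (simp add: field_simps)
      have "norm ((?E ** Q) *v x) = norm ((?E ** transpose A) *v z)"
        by (simp only: matrix_vector_mul_assoc[symmetric] z(1))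
      also have "\<dots> \<le> ?R * norm z" by (rule norm_matrix_vector_mult_le)
      also have "\<dots> \<le> ?R * (norm x / s)" using \<open>norm z \<le> norm x / s\<close> by (rule mult_left_mono) simp
      finally show "norm ((?E ** Q) *v x) \<le> ?R / s * norm x" by simp
    qed
    then have EQ: "(norm (?E ** Q))\<^sup>2 \<le> C\<^sub>2 * ?R\<^sup>2" by (simp add: C\<^sub>2_def power_divide)
    define K where "K = diag_matrix k"
    let ?P = "mat 1 - Q"
    let ?N = "norm (Q ** K ** ?P)"
    have symQ: "transpose Q = Q" "transpose ?P = ?P" "transpose K = K"
      using Q(1) orth_projection_complement[OF Q(1)] 
      by (auto simp: orth_projection_def K_def diag_matrix_def transpose_def vec_eq_iff)
    have "Q ** K ** ?P = - (transpose A ** ?E ** ?P) - transpose (?E ** Q) ** M ** ?P"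
    proof -
      have "transpose (M ** Q) = transpose A - transpose (?E ** Q)"
        by (simp add: matrix_mult.diff_left Q(3) transpose_diff)
      then have "Q ** transpose M = transpose A - transpose (?E ** Q)"
        by (simp add: matrix_transpose_mul symQ)
      then have "Q ** K ** ?P = (transpose A - transpose (?E ** Q)) ** M ** ?P"
        by (simp add: K_def gram[symmetric] matrix_mul_assoc)
      moreover have "A ** ?P = 0" by (simp add: matrix_mult.diff_right Q(3))
      then have "transpose A ** M ** ?P = - (transpose A ** ?E ** ?P)"
        by (simp add: matrix_mult.diff_left matrix_mult.diff_right matrix_mul_assoc[symmetric] Q(3))
      ultimately show ?thesis by (simp add: matrix_mult.diff_left)
    qed
    then have "?N \<le> norm (transpose A ** ?E ** ?P) + norm (transpose (?E ** Q) ** M ** ?P)"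
      using norm_triangle_ineq4[of "- (transpose A ** ?E ** ?P)"] by simp
    also have "\<dots> \<le> ?S + norm (transpose (?E ** Q) ** M)"
      by (intro add_mono norm_mult_complement_le Q(1))
    also have "norm (transpose (?E ** Q) ** M) \<le> norm (?E ** Q) * norm M"
      using norm_matrix_mult_le by (metis norm_transpose)
    finally have "?N \<le> ?S + norm (?E ** Q) * norm M" by simp
    then have "?N\<^sup>2 \<le> (?S + norm (?E ** Q) * norm M)\<^sup>2" by (intro power_mono) auto
    also have "\<dots> \<le> 2 * ?S\<^sup>2 + 2 * (norm (?E ** Q) * norm M)\<^sup>2"
      using sum_squares_bound[of ?S "norm (?E ** Q) * norm M"] by (simp add: power2_sum)
    also have "(norm (?E ** Q) * norm M)\<^sup>2 = m * (norm (?E ** Q))\<^sup>2"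
      by (simp add: power_mult_distrib m_def)
    also have "\<dots> \<le> m * (C\<^sub>2 * ?R\<^sup>2)" by (intro mult_left_mono EQ m)
    finally have N: "?N\<^sup>2 \<le> 2 * ?S\<^sup>2 + 2 * (m * (C\<^sub>2 * ?R\<^sup>2))" by simp
    have "(\<Sum>i\<in>UNIV. \<Sum>j\<in>UNIV. ((k i - k j) * Q $ i $ j)\<^sup>2) = (norm (K ** Q - Q ** K))\<^sup>2"
      by (simp add: norm_matrix_power2 K_def diag_matrix_mult_nth mult_diag_matrix_nth algebra_simps)
    also have "K ** Q - Q ** K = transpose (Q ** K ** ?P) - Q ** K ** ?P"
      by (simp add: matrix_transpose_mul symQ matrix_mult.diff_left matrix_mult.diff_right
          matrix_mul_assoc transpose_diff)
    also have "(norm (transpose (Q ** K ** ?P) - Q ** K ** ?P))\<^sup>2 \<le> (2 * ?N)\<^sup>2"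
    proof (rule power_mono)
      show "norm (transpose (Q ** K ** ?P) - Q ** K ** ?P) \<le> 2 * ?N"
        using norm_triangle_ineq4[of "transpose (Q ** K ** ?P)" "Q ** K ** ?P"] by (simp add: norm_transpose)
    qed simp
    finally have comm: "(\<Sum>i\<in>UNIV. \<Sum>j\<in>UNIV. ((k i - k j) * Q $ i $ j)\<^sup>2) \<le> 4 * ?N\<^sup>2"
      by (simp add: power_mult_distrib)
    have "d < l" using small objective by (smt (verit) zero_le_power2)
    then have "d \<le> C\<^sub>1 * (\<Sum>i\<in>UNIV. \<Sum>j\<in>UNIV. ((k i - k j) * Q $ i $ j)\<^sup>2)"
      using gap[OF Q(1,2)] by (simp add: d_def)
    also have "\<dots> \<le> C\<^sub>1 * (4 * (2 * ?S\<^sup>2 + 2 * (m * (C\<^sub>2 * ?R\<^sup>2))))"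
      using comm N C\<^sub>1 by (intro mult_left_mono) auto
    finally have "(norm (?E ** Q))\<^sup>2 + d \<le> C\<^sub>2 * ?R\<^sup>2 + C\<^sub>1 * (4 * (2 * ?S\<^sup>2 + 2 * (m * (C\<^sub>2 * ?R\<^sup>2))))"
      using EQ by simp
    also have "\<dots> \<le> (C\<^sub>2 + 8 * C\<^sub>1 + 8 * C\<^sub>1 * m * C\<^sub>2) * (?R\<^sup>2 + ?S\<^sup>2)"
    proof -
      have "0 \<le> 8 * C\<^sub>1 * ?R\<^sup>2" "0 \<le> C\<^sub>2 * ?S\<^sup>2" "0 \<le> 8 * C\<^sub>1 * m * C\<^sub>2 * ?S\<^sup>2"
        using C\<^sub>1 \<open>0 < C\<^sub>2\<close> m by auto
      then show ?thesis by (simp add: algebra_simps)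
    qed
    finally show "(norm ?E)\<^sup>2 - ((norm M)\<^sup>2 - (\<Sum>i\<in>I. k i)) \<le>
        (C\<^sub>2 + 8 * C\<^sub>1 + 8 * C\<^sub>1 * m * C\<^sub>2) * (?R\<^sup>2 + ?S\<^sup>2)"
      unfolding objective .
  qed
qed

text \<open>
  The diagonal case transported along \<open>A \<mapsto> A U\<^sup>T\<close>, where the rows of \<open>U\<close> are an eigenbasis of
  \<open>M\<^sup>T M\<close>. Attainment of the Eckart-Young bound identifies \<open>|A\<^sub>0 - M|\<^sup>2\<close> with its value.
\<close>

lemma low_rank_error_bound:
  fixes A\<^sub>0 M :: "real ^ 'n ^ 'm"
  assumes rank0: "rank A\<^sub>0 \<le> r" and rankM: "r \<le> rank M"
    and min: "\<And>A :: real ^ 'n ^ 'm. rank A \<le> r \<Longrightarrow> norm (A\<^sub>0 - M) \<le> norm (A - M)"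
  obtains \<rho> l C where "0 < \<rho>" "0 < l" "0 < C"
    "\<And>A. rank A \<le> r \<Longrightarrow> norm (A - A\<^sub>0) < \<rho> \<Longrightarrow> (norm (A - M))\<^sup>2 - (norm (A\<^sub>0 - M))\<^sup>2 < l \<Longrightarrow>
      (norm (A - M))\<^sup>2 - (norm (A\<^sub>0 - M))\<^sup>2
        \<le> C * ((norm ((A - M) ** transpose A))\<^sup>2 + (norm (transpose A ** (A - M)))\<^sup>2)"
proof -
  have rank_eq: "rank A\<^sub>0 = r" by (rule best_approximation_has_full_rank[OF rank0 rankM min])
  have "r \<le> CARD('n)" using rankM rank_bound[of M] by simp
  have "transpose (transpose M ** M) = transpose M ** M" by (simp add: matrix_transpose_mul)
  then obtain U k where U: "orthogonal_matrix U"
    and k: "\<And>i. (transpose M ** M) *v (U $ i) = k i *\<^sub>R U $ i"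
    using symmetric_matrix_diagonalization by metis
  have U': "orthogonal_matrix (transpose U)" using U by simp
  have UU: "transpose U ** U = mat 1" using U by (simp add: orthogonal_matrix_def)
  note gram = gram_matrix_in_eigenbasis[OF U k]
  obtain I t where I: "card I = r" "\<And>i. i \<in> I \<Longrightarrow> t \<le> k i" "\<And>i. i \<notin> I \<Longrightarrow> k i \<le> t"
    by (rule top_index_set[OF \<open>r \<le> CARD('n)\<close>, of k]) (rule that)
  let ?T = "\<lambda>A :: real ^ 'n ^ 'm. A ** transpose U"
  have T_norm: "norm (?T A - ?T B) = norm (A - B)" for A B
    by (simp add: norm_mult_orthogonal_matrix[OF U'] flip: matrix_mult.diff_left)
  have T_inv: "?T A ** U = A" for A by (simp add: matrix_mul_assoc[symmetric] UU)
  have T_rank: "rank (?T A) \<le> rank A" for A by (rule rank_mul_le_left)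
  have rankT: "rank (?T A\<^sub>0) = card I"
    using T_rank[of A\<^sub>0] rank_mul_le_left[of "?T A\<^sub>0" U] rank_eq I(1) by (simp add: T_inv)
  have opt: "(norm (A\<^sub>0 - M))\<^sup>2 = (norm (?T M))\<^sup>2 - (\<Sum>i\<in>I. k i)"
  proof (rule antisym)
    let ?D = "diag_matrix (\<lambda>i. if i \<in> I then 1 else 0) :: real ^ 'n ^ 'n"
    have "rank (?T M ** ?D ** U) \<le> r"
      using rank_mul_le_left[of "?T M ** ?D" U] rank_mult_indicator_le[of "?T M" I] I(1) by simp
    then have "norm (A\<^sub>0 - M) \<le> norm (?T M ** ?D ** U - M)" by (rule min)
    also have "?T M ** ?D ** U - M = (?T M ** ?D - ?T M) ** U"
      by (simp add: matrix_mult.diff_left T_inv)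
    finally have "(norm (A\<^sub>0 - M))\<^sup>2 \<le> (norm (?T M ** ?D - ?T M))\<^sup>2"
      by (simp add: norm_mult_orthogonal_matrix[OF U] power_mono)
    then show "(norm (A\<^sub>0 - M))\<^sup>2 \<le> (norm (?T M))\<^sup>2 - (\<Sum>i\<in>I. k i)"
      by (simp only: low_rank_objective_truncation[OF gram])
    show "(norm (?T M))\<^sup>2 - (\<Sum>i\<in>I. k i) \<le> (norm (A\<^sub>0 - M))\<^sup>2"
      using low_rank_objective_ge[OF gram I(2,3), where A = "?T A\<^sub>0"] rankT by (simp add: T_norm)
  qed
  obtain \<rho> l C where pos: "0 < \<rho>" "0 < l" "0 < C"
    and bound: "\<And>A. rank A \<le> card I \<Longrightarrow> norm (A - ?T A\<^sub>0) < \<rho> \<Longrightarrow>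
      (norm (A - ?T M))\<^sup>2 - ((norm (?T M))\<^sup>2 - (\<Sum>i\<in>I. k i)) < l \<Longrightarrow>
      (norm (A - ?T M))\<^sup>2 - ((norm (?T M))\<^sup>2 - (\<Sum>i\<in>I. k i))
        \<le> C * ((norm ((A - ?T M) ** transpose A))\<^sup>2 + (norm (transpose A ** (A - ?T M)))\<^sup>2)"
    by (rule low_rank_error_bound_diagonal[OF gram I(2,3) rankT]) (assumption+, rule that)
  show thesis
  proof (rule that[OF pos])
    fix A :: "real ^ 'n ^ 'm"
    assume A: "rank A \<le> r" "norm (A - A\<^sub>0) < \<rho>" "(norm (A - M))\<^sup>2 - (norm (A\<^sub>0 - M))\<^sup>2 < l"
    have "(?T A - ?T M) ** transpose (?T A) = (A - M) ** transpose A"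
    proof -
      have "(?T A - ?T M) ** transpose (?T A) = (A - M) ** (transpose U ** U) ** transpose A"
        by (simp add: matrix_transpose_mul matrix_mul_assoc flip: matrix_mult.diff_left)
      then show ?thesis by (simp add: UU)
    qed
    moreover have "norm (transpose (?T A) ** (?T A - ?T M)) = norm (transpose A ** (A - M))"
    proof -
      have "transpose (?T A) ** (?T A - ?T M) = U ** (transpose A ** (A - M)) ** transpose U"
        by (simp add: matrix_transpose_mul matrix_mul_assoc flip: matrix_mult.diff_left)
      then have "norm (transpose (?T A) ** (?T A - ?T M)) = norm (U ** (transpose A ** (A - M)))"
        by (simp add: norm_mult_orthogonal_matrix[OF U'])
      also have "\<dots> = norm (transpose (transpose A ** (A - M)) ** transpose U)"
        by (subst norm_transpose[symmetric]) (simp only: matrix_transpose_mul)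
      also have "\<dots> = norm (transpose A ** (A - M))"
        by (simp only: norm_mult_orthogonal_matrix[OF U'] norm_transpose)
      finally show ?thesis .
    qed
    moreover have "rank (?T A) \<le> card I" using A(1) T_rank[of A] I(1) by simp
    ultimately show "(norm (A - M))\<^sup>2 - (norm (A\<^sub>0 - M))\<^sup>2
        \<le> C * ((norm ((A - M) ** transpose A))\<^sup>2 + (norm (transpose A ** (A - M)))\<^sup>2)"
      using bound[of "?T A"] A(2,3) unfolding opt by (simp add: T_norm)
  qed
qed

section \<open>From the error bound to the exponent\<close>

lemmas isCont_matrix_intros =
  matrix_mult.continuous
  bounded_linear.continuous[OF linear_linear[THEN iffD2, OF linear_transpose]]

text \<open>
  The common form of the four problems: \<open>F\<close> maps the variable to the matrix that is compared with
  \<open>M\<close>, so \<open>F\<close> is the identity in the constrained problems and a product in the factorized ones.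
  What remains to be shown in each case is that subgradients dominate both residuals, uniformly
  on a bounded neighbourhood of \<open>x\<close>.
\<close>

lemma KL_exponent_half_if_low_rank_residual:
  fixes x :: "'a::euclidean_space" and F :: "'a \<Rightarrow> real ^ 'n ^ 'm"
  assumes x: "x \<in> E" "f x = ereal ((norm (F x - M))\<^sup>2)" "isCont F x"
    and rank: "rank (F x) \<le> r" "r \<le> rank M"
    and min: "\<And>A :: real ^ 'n ^ 'm. rank A \<le> r \<Longrightarrow> norm (F x - M) \<le> norm (A - M)"
    and dom: "\<And>y b. y \<in> E \<Longrightarrow> f y = ereal b \<Longrightarrow> b = (norm (F y - M))\<^sup>2 \<and> rank (F y) \<le> r"
    and left: "\<And>y v. y \<in> E \<Longrightarrow> norm y \<le> norm x + 1 \<Longrightarrow> v \<in> clarke_subdiff E f y \<Longrightarrow>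
      norm ((F y - M) ** transpose (F y)) \<le> c * norm v"
    and right: "\<And>y v. y \<in> E \<Longrightarrow> norm y \<le> norm x + 1 \<Longrightarrow> v \<in> clarke_subdiff E f y \<Longrightarrow>
      norm (transpose (F y) ** (F y - M)) \<le> c * norm v"
  shows "has_KL_exponent E f (1/2) x"
proof -
  obtain \<rho> l C where pos: "0 < \<rho>" "0 < l" "0 < C"
    and bound: "\<And>A. rank A \<le> r \<Longrightarrow> norm (A - F x) < \<rho> \<Longrightarrow>
      (norm (A - M))\<^sup>2 - (norm (F x - M))\<^sup>2 < l \<Longrightarrow> (norm (A - M))\<^sup>2 - (norm (F x - M))\<^sup>2
        \<le> C * ((norm ((A - M) ** transpose A))\<^sup>2 + (norm (transpose A ** (A - M)))\<^sup>2)"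
    by (rule low_rank_error_bound[OF rank min]) (assumption+, rule that)
  obtain d where d: "0 < d" "\<And>y. dist y x < d \<Longrightarrow> dist (F y) (F x) < \<rho>"
    using x(3) pos(1) unfolding continuous_at_eps_delta by metis
  show ?thesis
  proof (rule KL_exponent_half_if_sq_error_bound[where a = "(norm (F x - M))\<^sup>2" and \<rho> = "min d 1"
        and l = l and C = "C * (2 * c\<^sup>2) + 1"])
    show "x \<in> E" "f x = ereal ((norm (F x - M))\<^sup>2)" by (fact x)+
    show "0 < min d 1" "0 < l" using d pos by auto
    \<comment> \<open>the summand \<open>1\<close> makes the constant positive also for \<open>c = 0\<close>\<close>
    show "0 < C * (2 * c\<^sup>2) + 1" using pos by (intro add_nonneg_pos) auto
    fix y b v
    assume y: "y \<in> E" "dist x y < min d 1" "f y = ereal b" "b < (norm (F x - M))\<^sup>2 + l"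
      and v: "v \<in> clarke_subdiff E f y"
    have "norm y \<le> norm x + dist x y" by (metis add.commute dist_commute dist_norm norm_triangle_sub)
    then have norm_y: "norm y \<le> norm x + 1" using y(2) by simp
    have b: "b = (norm (F y - M))\<^sup>2" "rank (F y) \<le> r" using dom[OF y(1,3)] by auto
    have "(norm ((F y - M) ** transpose (F y)))\<^sup>2 \<le> (c * norm v)\<^sup>2"
      "(norm (transpose (F y) ** (F y - M)))\<^sup>2 \<le> (c * norm v)\<^sup>2"
      using left[OF y(1) norm_y v] right[OF y(1) norm_y v] by (auto intro!: power_mono)
    then have "C * ((norm ((F y - M) ** transpose (F y)))\<^sup>2 + (norm (transpose (F y) ** (F y - M)))\<^sup>2)
        \<le> C * (2 * (c * norm v)\<^sup>2)"
      using pos(3) by (intro mult_left_mono) auto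
    moreover have "norm (F y - F x) < \<rho>"
      using d(2)[of y] y(2) by (simp add: dist_commute[of x] dist_norm[of "F y"])
    ultimately have "b - (norm (F x - M))\<^sup>2 \<le> C * (2 * (c * norm v)\<^sup>2)"
      using bound[OF b(2)] y(4) b(1) by fastforce
    also have "\<dots> \<le> (C * (2 * c\<^sup>2) + 1) * (norm v)\<^sup>2"
      by (simp add: algebra_simps power_mult_distrib)
    finally show "b - (norm (F x - M))\<^sup>2 \<le> (C * (2 * c\<^sup>2) + 1) * (norm v)\<^sup>2" .
  qed
qed

lemma norm_le_if_power2_le_mult:
  "(norm a)\<^sup>2 \<le> b * norm a \<Longrightarrow> 0 \<le> b \<Longrightarrow> norm a \<le> b"
  by (cases "a = 0") (simp_all add: power2_eq_square)

lemma inner_le_norm_mult: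
  assumes "v \<bullet> w = c" "norm v \<le> p" "norm w \<le> q"
  shows "c \<le> p * q"
  using norm_cauchy_schwarz[of v w] mult_mono[OF assms(2,3)] assms(1) order_trans[OF norm_ge_zero assms(2)]
  by simp

subsection \<open>The constrained problem on rectangular matrices\<close>

lemma g_asym_eq: "g_asym r M A = (if rank A \<le> r then ereal ((norm (A - M))\<^sup>2) else \<infinity>)"
  by (simp add: g_asym_def indicator_fun_def rank_le_matrices_def)

text \<open>
  The curves \<open>(1 + t W) B\<close> and \<open>B (1 + t Z)\<close> have rank at most that of \<open>B\<close>.
\<close>

lemma clarke_subdiff_g_asym:
  fixes M :: "real ^ 'n ^ 'm"
  assumes v: "v \<in> clarke_subdiff UNIV (g_asym r M) A"
  shows "v \<bullet> (W ** A) = 2 * ((A - M) \<bullet> (W ** A))" "v \<bullet> (A ** Z) = 2 * ((A - M) \<bullet> (A ** Z))"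
proof -
  have rk: "rank B \<le> r" if "u \<in> regular_subdiff UNIV (g_asym r M) B" for u B
    using that by (auto simp: regular_subdiff_def edom_def g_asym_eq split: if_splits)
  show "v \<bullet> (W ** A) = 2 * ((A - M) \<bullet> (W ** A))"
  proof (rule clarke_subdiff_linear_identity[OF _ _ _ v, of "\<lambda>B. W ** B" "\<lambda>B. 2 * ((B - M) \<bullet> (W ** B))"])
    fix B u assume u: "u \<in> regular_subdiff UNIV (g_asym r M) B"
    show "u \<bullet> (W ** B) = 2 * ((B - M) \<bullet> (W ** B))"
    proof (rule regular_subdiff_quadratic_curve[OF u UNIV_I, where z = 0 and Z = 0])
      fix t :: real
      have "B + t *\<^sub>R (W ** B) + t\<^sup>2 *\<^sub>R 0 = (mat 1 + t *\<^sub>R W) ** B"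
        by (simp add: matrix_mult.add_left matrix_mult.scaleR_left)
      then have "rank (B + t *\<^sub>R (W ** B) + t\<^sup>2 *\<^sub>R 0) \<le> r"
        using rk[OF u] rank_mul_le_right[of _ B] by (metis order_trans)
      then show "g_asym r M (B + t *\<^sub>R (W ** B) + t\<^sup>2 *\<^sub>R 0) =
          ereal ((norm (B - M + t *\<^sub>R (W ** B) + t\<^sup>2 *\<^sub>R 0))\<^sup>2)"
        by (simp add: g_asym_eq algebra_simps)
    qed
  qed (intro continuous_intros isCont_matrix_intros)+
  show "v \<bullet> (A ** Z) = 2 * ((A - M) \<bullet> (A ** Z))"
  proof (rule clarke_subdiff_linear_identity[OF _ _ _ v, of "\<lambda>B. B ** Z" "\<lambda>B. 2 * ((B - M) \<bullet> (B ** Z))"])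
    fix B u assume u: "u \<in> regular_subdiff UNIV (g_asym r M) B"
    show "u \<bullet> (B ** Z) = 2 * ((B - M) \<bullet> (B ** Z))"
    proof (rule regular_subdiff_quadratic_curve[OF u UNIV_I, where z = 0 and Z = 0])
      fix t :: real
      have "B + t *\<^sub>R (B ** Z) + t\<^sup>2 *\<^sub>R 0 = B ** (mat 1 + t *\<^sub>R Z)"
        by (simp add: matrix_mult.add_right matrix_mult.scaleR_right)
      then have "rank (B + t *\<^sub>R (B ** Z) + t\<^sup>2 *\<^sub>R 0) \<le> r"
        using rk[OF u] rank_mul_le_left[of B] by (metis order_trans)
      then show "g_asym r M (B + t *\<^sub>R (B ** Z) + t\<^sup>2 *\<^sub>R 0) =
          ereal ((norm (B - M + t *\<^sub>R (B ** Z) + t\<^sup>2 *\<^sub>R 0))\<^sup>2)"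
        by (simp add: g_asym_eq algebra_simps)
    qed
  qed (intro continuous_intros isCont_matrix_intros)+
qed

lemma KL_exponent_g_asym:
  fixes M A :: "real ^ 'n ^ 'm"
  assumes rM: "r \<le> rank M" and A: "is_arg_min (g_asym r M) (\<lambda>A. A \<in> UNIV) A"
  shows "has_KL_exponent UNIV (g_asym r M) (1/2) A"
proof -
  have le: "g_asym r M A \<le> g_asym r M B" for B
    using A by (auto simp: is_arg_min_def not_less)
  have "g_asym r M A < \<infinity>" using le[of 0] by (auto simp: g_asym_eq split: if_splits)
  then have rA: "rank A \<le> r" by (simp add: g_asym_eq split: if_splits)
  show ?thesis
  proof (rule KL_exponent_half_if_low_rank_residual[where F = "\<lambda>B. B" and c = "norm A + 1" and M = M and r = r])
    show "norm (A - M) \<le> norm (B - M)" if "rank B \<le> r" for B :: "real ^ 'n ^ 'm"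
      using le[of B] that rA by (simp add: g_asym_eq)
    fix B v :: "real ^ 'n ^ 'm"
    assume B: "norm B \<le> norm A + 1" and v: "v \<in> clarke_subdiff UNIV (g_asym r M) B"
    let ?E = "B - M"
    let ?R = "?E ** transpose B" and ?S = "transpose B ** ?E"
    have "v \<bullet> (?R ** B) = 2 * (norm ?R)\<^sup>2"
      using clarke_subdiff_g_asym(1)[OF v, of ?R]
      by (simp only: power2_norm_eq_inner inner_matrix_mult_right[of ?E])
    then have "2 * (norm ?R)\<^sup>2 \<le> norm v * (norm ?R * (norm A + 1))"
    proof (rule inner_le_norm_mult)
      show "norm (?R ** B) \<le> norm ?R * (norm A + 1)"
        using norm_matrix_mult_le[of ?R B] mult_left_mono[OF B, of "norm ?R"] by simp
    qed simp
    also have "\<dots> = (norm A + 1) * norm v * norm ?R" by (simp only: mult_ac)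
    finally have "(norm ?R)\<^sup>2 \<le> (norm A + 1) * norm v * norm ?R"
      using zero_le_power2[of "norm ?R"] by linarith
    then show "norm ?R \<le> (norm A + 1) * norm v"
      by (rule norm_le_if_power2_le_mult) simp
    have "v \<bullet> (B ** ?S) = 2 * (norm ?S)\<^sup>2"
      using clarke_subdiff_g_asym(2)[OF v, of ?S]
      by (simp only: power2_norm_eq_inner inner_matrix_mult_left[of ?E])
    then have "2 * (norm ?S)\<^sup>2 \<le> norm v * ((norm A + 1) * norm ?S)"
    proof (rule inner_le_norm_mult)
      show "norm (B ** ?S) \<le> (norm A + 1) * norm ?S"
        using norm_matrix_mult_le[of B ?S] mult_right_mono[OF B, of "norm ?S"] by simp
    qed simp
    also have "\<dots> = (norm A + 1) * norm v * norm ?S" by (simp only: mult_ac)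
    finally have "(norm ?S)\<^sup>2 \<le> (norm A + 1) * norm v * norm ?S"
      using zero_le_power2[of "norm ?S"] by linarith
    then show "norm ?S \<le> (norm A + 1) * norm v"
      by (rule norm_le_if_power2_le_mult) simp
  qed (use rM rA in \<open>auto simp: g_asym_eq split: if_splits\<close>)
qed

subsection \<open>The factorized problem on rectangular matrices\<close>

lemma clarke_subdiff_f_asym:
  fixes M :: "real ^ 'n ^ 'm" and X :: "real ^ 'r ^ 'm" and Y :: "real ^ 'n ^ 'r"
  assumes v: "v \<in> clarke_subdiff UNIV (f_asym M) (X, Y)"
  shows "fst v \<bullet> W = 2 * ((X ** Y - M) \<bullet> (W ** Y))" "snd v \<bullet> Z = 2 * ((X ** Y - M) \<bullet> (X ** Z))"
proof -
  have "v \<bullet> (W, 0) = 2 * ((fst (X, Y) ** snd (X, Y) - M) \<bullet> (W ** snd (X, Y)))"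
  proof (rule clarke_subdiff_linear_identity[OF _ _ _ v, of "\<lambda>_. (W, 0)"
        "\<lambda>p. 2 * ((fst p ** snd p - M) \<bullet> (W ** snd p))"])
    fix p :: "(real ^ 'r ^ 'm) \<times> (real ^ 'n ^ 'r)" and u
    assume u: "u \<in> regular_subdiff UNIV (f_asym M) p"
    show "u \<bullet> (W, 0) = 2 * ((fst p ** snd p - M) \<bullet> (W ** snd p))"
    proof (rule regular_subdiff_quadratic_curve[OF u UNIV_I, where z = 0 and Z = 0])
      fix t :: real
      show "f_asym M (p + t *\<^sub>R (W, 0) + t\<^sup>2 *\<^sub>R 0) =
          ereal ((norm (fst p ** snd p - M + t *\<^sub>R (W ** snd p) + t\<^sup>2 *\<^sub>R 0))\<^sup>2)"
        by (cases p) (simp add: f_asym_def matrix_mult.add_left matrix_mult.scaleR_left algebra_simps)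
    qed
  qed (intro continuous_intros isCont_matrix_intros)+
  then show "fst v \<bullet> W = 2 * ((X ** Y - M) \<bullet> (W ** Y))" by (cases v) simp
  have "v \<bullet> (0, Z) = 2 * ((fst (X, Y) ** snd (X, Y) - M) \<bullet> (fst (X, Y) ** Z))"
  proof (rule clarke_subdiff_linear_identity[OF _ _ _ v, of "\<lambda>_. (0, Z)"
        "\<lambda>p. 2 * ((fst p ** snd p - M) \<bullet> (fst p ** Z))"])
    fix p :: "(real ^ 'r ^ 'm) \<times> (real ^ 'n ^ 'r)" and u
    assume u: "u \<in> regular_subdiff UNIV (f_asym M) p"
    show "u \<bullet> (0, Z) = 2 * ((fst p ** snd p - M) \<bullet> (fst p ** Z))"
    proof (rule regular_subdiff_quadratic_curve[OF u UNIV_I, where z = 0 and Z = 0])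
      fix t :: real
      show "f_asym M (p + t *\<^sub>R (0, Z) + t\<^sup>2 *\<^sub>R 0) =
          ereal ((norm (fst p ** snd p - M + t *\<^sub>R (fst p ** Z) + t\<^sup>2 *\<^sub>R 0))\<^sup>2)"
        by (cases p) (simp add: f_asym_def matrix_mult.add_right matrix_mult.scaleR_right algebra_simps)
    qed
  qed (intro continuous_intros isCont_matrix_intros)+
  then show "snd v \<bullet> Z = 2 * ((X ** Y - M) \<bullet> (X ** Z))" by (cases v) simp
qed

lemma rank_factor_le: "rank (X ** Y) \<le> CARD('r)"
  for X :: "real ^ 'r ^ 'm" and Y :: "real ^ 'n ^ 'r"
  using rank_mul_le_left[of X Y] rank_bound[of X] by simp

text \<open>
  By \<open>low_rank_factorization\<close>, minimizing over factors is minimizing over all matrices of rank at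
  most \<open>r\<close>.
\<close>

lemma KL_exponent_f_asym:
  fixes M :: "real ^ 'n ^ 'm" and p :: "(real ^ 'r ^ 'm) \<times> (real ^ 'n ^ 'r)"
  assumes rM: "CARD('r) \<le> rank M" and p: "is_arg_min (f_asym M) (\<lambda>p. p \<in> UNIV) p"
  shows "has_KL_exponent UNIV (f_asym M) (1/2) p"
proof -
  have le: "f_asym M p \<le> f_asym M q" for q :: "(real ^ 'r ^ 'm) \<times> (real ^ 'n ^ 'r)"
    using p unfolding is_arg_min_def by (meson UNIV_I not_less)
  have f: "f_asym M q = ereal ((norm (fst q ** snd q - M))\<^sup>2)"
    for q :: "(real ^ 'r ^ 'm) \<times> (real ^ 'n ^ 'r)"
    by (simp add: f_asym_def case_prod_beta)
  let ?c = "norm p + 1"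
  show ?thesis
  proof (rule KL_exponent_half_if_low_rank_residual[where F = "\<lambda>q. fst q ** snd q" and c = ?c
        and M = M and r = "CARD('r)"])
    show "norm (fst p ** snd p - M) \<le> norm (B - M)" if rB: "rank B \<le> CARD('r)" for B :: "real ^ 'n ^ 'm"
    proof -
      obtain X :: "real ^ 'r ^ 'm" and Y :: "real ^ 'n ^ 'r" where "B = X ** Y"
        using low_rank_factorization[OF rB] by metis
      then show ?thesis using le[of "(X, Y)"] by (simp add: f)
    qed
    show "isCont (\<lambda>q. fst q ** snd q) p" by (intro continuous_intros isCont_matrix_intros)
    fix q :: "(real ^ 'r ^ 'm) \<times> (real ^ 'n ^ 'r)" and v
    assume q: "norm q \<le> ?c" and v: "v \<in> clarke_subdiff UNIV (f_asym M) q"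
    obtain X Y where q_eq: "q = (X, Y)" by (cases q)
    have XY: "norm X \<le> ?c" "norm Y \<le> ?c"
      using q norm_fst_le[of X Y] norm_snd_le[of Y X] by (simp_all add: q_eq)
    let ?E = "X ** Y - M"
    note v = v[unfolded q_eq]
    let ?R = "?E ** transpose Y" and ?S = "transpose X ** ?E"
    have "fst v \<bullet> ?R = 2 * (norm ?R)\<^sup>2"
      unfolding clarke_subdiff_f_asym(1)[OF v]
      by (simp only: power2_norm_eq_inner inner_matrix_mult_right[of ?E])
    then have "2 * (norm ?R)\<^sup>2 \<le> norm v * norm ?R"
      by (rule inner_le_norm_mult) (cases v, simp_all add: norm_fst_le)
    then have "(norm ?R)\<^sup>2 \<le> norm v * norm ?R" using zero_le_power2[of "norm ?R"] by linarith
    then have R: "norm ?R \<le> norm v" by (rule norm_le_if_power2_le_mult) simp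
    have "?E ** transpose (X ** Y) = ?R ** transpose X"
      by (simp add: matrix_transpose_mul matrix_mul_assoc)
    then have "norm (?E ** transpose (X ** Y)) \<le> norm v * ?c"
      using norm_matrix_mult_le[of ?R "transpose X"] mult_mono[OF R XY(1)] by (simp add: norm_transpose)
    then show "norm ((fst q ** snd q - M) ** transpose (fst q ** snd q)) \<le> ?c * norm v"
      by (simp add: q_eq mult.commute)
    have "snd v \<bullet> ?S = 2 * (norm ?S)\<^sup>2"
      unfolding clarke_subdiff_f_asym(2)[OF v]
      by (simp only: power2_norm_eq_inner inner_matrix_mult_left[of ?E])
    then have "2 * (norm ?S)\<^sup>2 \<le> norm v * norm ?S"
      by (rule inner_le_norm_mult) (cases v, simp_all add: norm_snd_le)
    then have "(norm ?S)\<^sup>2 \<le> norm v * norm ?S" using zero_le_power2[of "norm ?S"] by linarith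
    then have S: "norm ?S \<le> norm v" by (rule norm_le_if_power2_le_mult) simp
    have "transpose (X ** Y) ** ?E = transpose Y ** ?S"
      by (simp add: matrix_transpose_mul matrix_mul_assoc)
    then have "norm (transpose (X ** Y) ** ?E) \<le> ?c * norm v"
      using norm_matrix_mult_le[of "transpose Y" ?S] mult_mono[OF XY(2) S] by (simp add: norm_transpose)
    then show "norm (transpose (fst q ** snd q) ** (fst q ** snd q - M)) \<le> ?c * norm v"
      by (simp add: q_eq)
  qed (use rM in \<open>auto simp: f rank_factor_le\<close>)
qed

subsection \<open>The constrained problem on symmetric matrices\<close>

lemma g_sym_eq:
  "g_sym r M A = (if transpose A = A \<and> rank A \<le> r then ereal ((norm (A - M))\<^sup>2) else \<infinity>)"
  by (simp add: g_sym_def indicator_fun_def rank_le_matrices_def sym_matrices_def)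

text \<open>
  The congruences \<open>(1 + t W) B (1 + t W)\<^sup>T\<close> preserve symmetry as well as the rank bound.
\<close>

lemma clarke_subdiff_g_sym:
  fixes M :: "real ^ 'n ^ 'n"
  assumes v: "v \<in> clarke_subdiff sym_matrices (g_sym r M) A"
  shows "v \<bullet> (W ** A + A ** transpose W) = 2 * ((A - M) \<bullet> (W ** A + A ** transpose W))"
proof (rule clarke_subdiff_linear_identity[OF _ _ _ v, of "\<lambda>B. W ** B + B ** transpose W"
      "\<lambda>B. 2 * ((B - M) \<bullet> (W ** B + B ** transpose W))"])
  fix B u assume u: "u \<in> regular_subdiff sym_matrices (g_sym r M) B"
  then have B: "transpose B = B" "rank B \<le> r"
    by (auto simp: regular_subdiff_def edom_def g_sym_eq split: if_splits)
  let ?V = "W ** B + B ** transpose W" and ?Z = "W ** B ** transpose W"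
  have curve: "B + t *\<^sub>R ?V + t\<^sup>2 *\<^sub>R ?Z = (mat 1 + t *\<^sub>R W) ** B ** transpose (mat 1 + t *\<^sub>R W)" for t
    by (simp add: transpose_add transpose_scalar matrix_mult.add_left matrix_mult.add_right
        matrix_mult.scaleR_left matrix_mult.scaleR_right power2_eq_square algebra_simps)
  have sym: "transpose (B + t *\<^sub>R ?V + t\<^sup>2 *\<^sub>R ?Z) = B + t *\<^sub>R ?V + t\<^sup>2 *\<^sub>R ?Z" for t
    unfolding curve by (simp add: matrix_transpose_mul B matrix_mul_assoc)
  show "u \<bullet> ?V = 2 * ((B - M) \<bullet> ?V)"
  proof (rule regular_subdiff_quadratic_curve[OF u])
    fix t
    show "B + t *\<^sub>R ?V + t\<^sup>2 *\<^sub>R ?Z \<in> sym_matrices" using sym by (simp add: sym_matrices_def)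
    have "rank (B + t *\<^sub>R ?V + t\<^sup>2 *\<^sub>R ?Z) \<le> r"
      unfolding curve using rank_mul_le_left rank_mul_le_right B(2) by (metis order_trans)
    then show "g_sym r M (B + t *\<^sub>R ?V + t\<^sup>2 *\<^sub>R ?Z) =
        ereal ((norm (B - M + t *\<^sub>R ?V + t\<^sup>2 *\<^sub>R ?Z))\<^sup>2)"
      unfolding g_sym_eq by (simp only: sym) (simp add: algebra_simps)
  qed
qed (intro continuous_intros isCont_matrix_intros)+

text \<open>
  The comparison with \<open>X X\<^sup>T\<close> shows that \<open>A\<close> is optimal among all matrices of rank at most \<open>r\<close>. As
  \<open>B\<close> and \<open>M\<close> are symmetric, the two residuals are transposes of each other, and both summands of
  the test direction contribute the same amount to its inner product with \<open>B - M\<close>.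
\<close>

lemma KL_exponent_g_sym:
  fixes M A :: "real ^ 'n ^ 'n"
  assumes M: "M \<in> psd_matrices" and rM: "CARD('r::finite) \<le> rank M"
    and A: "is_arg_min (g_sym CARD('r) M) (\<lambda>A. A \<in> sym_matrices) A"
  shows "has_KL_exponent sym_matrices (g_sym CARD('r) M) (1/2) A"
proof -
  let ?g = "g_sym CARD('r) M"
  have symM: "transpose M = M" using M by (simp add: psd_matrices_def sym_matrices_def)
  have A_sym: "A \<in> sym_matrices" using A by (simp add: is_arg_min_def)
  have le: "?g A \<le> ?g B" if "transpose B = B" for B
    using A that by (auto simp: is_arg_min_def not_less sym_matrices_def)
  have "?g A < \<infinity>" using le[of 0] by (auto simp: g_sym_eq transpose_def vec_eq_iff split: if_splits)
  then have rA: "rank A \<le> CARD('r)" by (simp add: g_sym_eq split: if_splits)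
  obtain X :: "real ^ 'r ^ 'n"
    where X: "\<And>B :: real ^ 'n ^ 'n. rank B \<le> CARD('r) \<Longrightarrow> norm (X ** transpose X - M) \<le> norm (B - M)"
    using psd_best_approximation_is_square[OF M, where 'r = 'r] rM rank_bound[of M] by auto
  have "norm (A - M) \<le> norm (X ** transpose X - M)"
    using le[of "X ** transpose X"] rA A_sym
    by (simp add: g_sym_eq matrix_transpose_mul rank_factor_le sym_matrices_def)
  note min = order_trans[OF this X]
  have residual: "norm ((B - M) ** B) \<le> (norm A + 1) * norm v"
    if B: "transpose B = B" "norm B \<le> norm A + 1" and v: "v \<in> clarke_subdiff sym_matrices ?g B" for B v
  proof -
    let ?E = "B - M"
    let ?R = "?E ** B"
    have E: "transpose ?E = ?E" by (simp add: transpose_diff B symM)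
    have "?E \<bullet> (B ** transpose ?R) = transpose ?E \<bullet> transpose (?R ** B)"
      by (simp add: E matrix_transpose_mul B matrix_mul_assoc)
    then have "?E \<bullet> (B ** transpose ?R) = ?E \<bullet> (?R ** B)" by (simp only: inner_transpose)
    moreover have "?E \<bullet> (?R ** B) = (norm ?R)\<^sup>2"
      by (simp only: power2_norm_eq_inner inner_matrix_mult_right[of ?E] B)
    ultimately have "v \<bullet> (?R ** B + B ** transpose ?R) = 4 * (norm ?R)\<^sup>2"
      unfolding clarke_subdiff_g_sym[OF v] by (simp add: inner_add_right)
    then have "4 * (norm ?R)\<^sup>2 \<le> norm v * (norm ?R * (norm A + 1) + (norm A + 1) * norm ?R)"
    proof (rule inner_le_norm_mult)
      show "norm (?R ** B + B ** transpose ?R) \<le> norm ?R * (norm A + 1) + (norm A + 1) * norm ?R"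
        using norm_matrix_mult_le[of ?R B] norm_matrix_mult_le[of B "transpose ?R", unfolded norm_transpose]
          mult_left_mono[OF B(2) norm_ge_zero[of ?R]] mult_right_mono[OF B(2) norm_ge_zero[of ?R]]
          norm_triangle_ineq[of "?R ** B" "B ** transpose ?R"] by linarith
    qed simp
    then have "4 * (norm ?R)\<^sup>2 \<le> 2 * ((norm A + 1) * norm v * norm ?R)" by (simp add: algebra_simps)
    then have "(norm ?R)\<^sup>2 \<le> (norm A + 1) * norm v * norm ?R"
      using zero_le_power2[of "norm ?R"] by linarith
    then show ?thesis by (rule norm_le_if_power2_le_mult) simp
  qed
  show ?thesis
  proof (rule KL_exponent_half_if_low_rank_residual[where F = "\<lambda>B. B" and c = "norm A + 1" and M = M
        and r = "CARD('r)"])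
    show "norm (A - M) \<le> norm (B - M)" if "rank B \<le> CARD('r)" for B :: "real ^ 'n ^ 'n"
      using that by (rule min)
    fix B v :: "real ^ 'n ^ 'n"
    assume "B \<in> sym_matrices" and B: "norm B \<le> norm A + 1" and v: "v \<in> clarke_subdiff sym_matrices ?g B"
    then have sym: "transpose B = B" by (simp add: sym_matrices_def)
    show "norm ((B - M) ** transpose B) \<le> (norm A + 1) * norm v"
      using residual[OF sym B v] by (simp add: sym)
    have "transpose B ** (B - M) = transpose ((B - M) ** B)"
      by (simp add: matrix_transpose_mul transpose_diff sym symM)
    then show "norm (transpose B ** (B - M)) \<le> (norm A + 1) * norm v"
      using residual[OF sym B v] by (simp only: norm_transpose)
  qed (use rM rA A_sym in \<open>auto simp: g_sym_eq sym_matrices_def split: if_splits\<close>)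
qed

subsection \<open>The factorized problem on symmetric matrices\<close>

lemma clarke_subdiff_f_sym:
  fixes M :: "real ^ 'n ^ 'n" and X :: "real ^ 'r ^ 'n"
  assumes v: "v \<in> clarke_subdiff UNIV (f_sym M) X"
  shows "v \<bullet> W = 2 * ((X ** transpose X - M) \<bullet> (W ** transpose X + X ** transpose W))"
proof (rule clarke_subdiff_linear_identity[OF _ _ _ v, of "\<lambda>_. W"
      "\<lambda>X. 2 * ((X ** transpose X - M) \<bullet> (W ** transpose X + X ** transpose W))"])
  fix X :: "real ^ 'r ^ 'n" and u assume u: "u \<in> regular_subdiff UNIV (f_sym M) X"
  show "u \<bullet> W = 2 * ((X ** transpose X - M) \<bullet> (W ** transpose X + X ** transpose W))"
  proof (rule regular_subdiff_quadratic_curve[OF u UNIV_I, where z = 0 and Z = "W ** transpose W"])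
    fix t
    have "(X + t *\<^sub>R W) ** transpose (X + t *\<^sub>R W) - M = X ** transpose X - M +
        t *\<^sub>R (W ** transpose X + X ** transpose W) + t\<^sup>2 *\<^sub>R (W ** transpose W)"
      by (simp add: transpose_add transpose_scalar matrix_mult.add_left matrix_mult.add_right
          matrix_mult.scaleR_left matrix_mult.scaleR_right power2_eq_square algebra_simps)
    moreover have "f_sym M (X + t *\<^sub>R W + t\<^sup>2 *\<^sub>R 0) =
        ereal ((norm ((X + t *\<^sub>R W) ** transpose (X + t *\<^sub>R W) - M))\<^sup>2)"
      by (simp add: f_sym_def)
    ultimately show "f_sym M (X + t *\<^sub>R W + t\<^sup>2 *\<^sub>R 0) = ereal ((norm (X ** transpose X - M +
        t *\<^sub>R (W ** transpose X + X ** transpose W) + t\<^sup>2 *\<^sub>R (W ** transpose W)))\<^sup>2)"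
      by (simp only:)
  qed
qed (intro continuous_intros isCont_matrix_intros)+

text \<open>
  With \<open>E = Y Y\<^sup>T - M\<close> the gradient is \<open>4 E Y\<close>, and the residual \<open>E Y Y\<^sup>T\<close> is \<open>E Y\<close> times \<open>Y\<^sup>T\<close>.
\<close>

lemma KL_exponent_f_sym:
  fixes M :: "real ^ 'n ^ 'n" and X :: "real ^ 'r ^ 'n"
  assumes M: "M \<in> psd_matrices" and rM: "CARD('r) \<le> rank M"
    and X: "is_arg_min (f_sym M) (\<lambda>X. X \<in> UNIV) X"
  shows "has_KL_exponent UNIV (f_sym M) (1/2) X"
proof -
  have symM: "transpose M = M" using M by (simp add: psd_matrices_def sym_matrices_def)
  obtain X\<^sub>0 :: "real ^ 'r ^ 'n"
    where X\<^sub>0: "\<And>B :: real ^ 'n ^ 'n. rank B \<le> CARD('r) \<Longrightarrow> norm (X\<^sub>0 ** transpose X\<^sub>0 - M) \<le> norm (B - M)"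
    using psd_best_approximation_is_square[OF M, where 'r = 'r] rM rank_bound[of M] by auto
  have "f_sym M X \<le> f_sym M X\<^sub>0" using X by (auto simp: is_arg_min_def not_less)
  then have "norm (X ** transpose X - M) \<le> norm (X\<^sub>0 ** transpose X\<^sub>0 - M)" by (simp add: f_sym_def)
  note min = order_trans[OF this X\<^sub>0]
  have residual: "norm ((Y ** transpose Y - M) ** (Y ** transpose Y)) \<le> (norm X + 1) * norm v"
    if Y: "norm Y \<le> norm X + 1" and v: "v \<in> clarke_subdiff UNIV (f_sym M) Y" for Y v
  proof -
    let ?E = "Y ** transpose Y - M"
    let ?R = "?E ** Y"
    have E: "transpose ?E = ?E" by (simp add: transpose_diff matrix_transpose_mul symM)
    have "?E \<bullet> (Y ** transpose ?R) = transpose ?E \<bullet> transpose (?R ** transpose Y)"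
      by (simp add: E matrix_transpose_mul matrix_mul_assoc)
    then have "?E \<bullet> (Y ** transpose ?R) = ?E \<bullet> (?R ** transpose Y)" by (simp only: inner_transpose)
    moreover have "?E \<bullet> (?R ** transpose Y) = (norm ?R)\<^sup>2"
      by (simp only: power2_norm_eq_inner inner_matrix_mult_right[of ?E] transpose_transpose)
    ultimately have "v \<bullet> ?R = 4 * (norm ?R)\<^sup>2"
      unfolding clarke_subdiff_f_sym[OF v] by (simp add: inner_add_right)
    then have "4 * (norm ?R)\<^sup>2 \<le> norm v * norm ?R" by (rule inner_le_norm_mult) simp_all
    then have "(norm ?R)\<^sup>2 \<le> norm v * norm ?R" using zero_le_power2[of "norm ?R"] by linarith
    then have R: "norm ?R \<le> norm v" by (rule norm_le_if_power2_le_mult) simp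
    have "norm (?R ** transpose Y) \<le> norm v * (norm X + 1)"
      using norm_matrix_mult_le[of ?R "transpose Y"] mult_mono[OF R Y] by (simp add: norm_transpose)
    then show ?thesis by (simp add: matrix_mul_assoc mult.commute)
  qed
  show ?thesis
  proof (rule KL_exponent_half_if_low_rank_residual[where F = "\<lambda>Y. Y ** transpose Y" and c = "norm X + 1"
        and M = M and r = "CARD('r)"])
    show "norm (X ** transpose X - M) \<le> norm (B - M)" if "rank B \<le> CARD('r)" for B :: "real ^ 'n ^ 'n"
      using that by (rule min)
    show "isCont (\<lambda>Y. Y ** transpose Y) X" by (intro continuous_intros isCont_matrix_intros)
    fix Y v assume Y: "norm Y \<le> norm X + 1" and v: "v \<in> clarke_subdiff UNIV (f_sym M) Y"
    have sym: "transpose (Y ** transpose Y) = Y ** transpose Y" by (simp add: matrix_transpose_mul)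
    show "norm ((Y ** transpose Y - M) ** transpose (Y ** transpose Y)) \<le> (norm X + 1) * norm v"
      unfolding sym by (rule residual[OF Y v])
    have "transpose (Y ** transpose Y) ** (Y ** transpose Y - M) =
        transpose ((Y ** transpose Y - M) ** (Y ** transpose Y))"
      by (simp only: matrix_transpose_mul transpose_diff transpose_transpose symM)
    then show "norm (transpose (Y ** transpose Y) ** (Y ** transpose Y - M)) \<le> (norm X + 1) * norm v"
      using residual[OF Y v] by (simp only: norm_transpose)
  qed (use rM in \<open>auto simp: f_sym_def rank_factor_le\<close>)
qed

theorem corollary4p13:
  shows
    "(\<forall>M :: real ^ 'n::finite ^ 'm::finite. singval M CARD('r::finite) > 0 \<longrightarrow>
        (\<forall>A. is_arg_min (g_asym CARD('r) M) (\<lambda>A. A \<in> UNIV) A \<longrightarrow>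
          has_KL_exponent UNIV (g_asym CARD('r) M) (1/2) A) \<and>
        (\<forall>Z :: (real ^ 'r ^ 'm) \<times> (real ^ 'n ^ 'r).
          is_arg_min (f_asym M) (\<lambda>Z. Z \<in> UNIV) Z \<longrightarrow>
          has_KL_exponent UNIV (f_asym M) (1/2) Z)) \<and>
     (\<forall>M \<in> psd_matrices :: (real ^ 'n ^ 'n) set. eigval M CARD('r) > 0 \<longrightarrow>
        (\<forall>A. is_arg_min (g_sym CARD('r) M) (\<lambda>A. A \<in> sym_matrices) A \<longrightarrow>
          has_KL_exponent sym_matrices (g_sym CARD('r) M) (1/2) A) \<and>
        (\<forall>X :: real ^ 'r ^ 'n.
          is_arg_min (f_sym M) (\<lambda>X. X \<in> UNIV) X \<longrightarrow>
          has_KL_exponent UNIV (f_sym M) (1/2) X))"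
proof (intro conjI allI ballI impI)
  fix M :: "real ^ 'n ^ 'm"
  assume "singval M CARD('r) > 0"
  then have rM: "CARD('r) \<le> rank M" by (rule rank_ge_if_singval_pos)
  show "has_KL_exponent UNIV (g_asym CARD('r) M) (1/2) A"
    if "is_arg_min (g_asym CARD('r) M) (\<lambda>A. A \<in> UNIV) A" for A
    using rM that by (rule KL_exponent_g_asym)
  show "has_KL_exponent UNIV (f_asym M) (1/2) Z"
    if "is_arg_min (f_asym M) (\<lambda>Z. Z \<in> UNIV) Z" for Z :: "(real ^ 'r ^ 'm) \<times> (real ^ 'n ^ 'r)"
    using rM that by (rule KL_exponent_f_asym)
next
  fix M :: "real ^ 'n ^ 'n"
  assume M: "M \<in> psd_matrices" and "eigval M CARD('r) > 0"
  then have rM: "CARD('r) \<le> rank M"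
    by (intro rank_ge_if_eigval_pos) (auto simp: psd_matrices_def sym_matrices_def)
  show "has_KL_exponent sym_matrices (g_sym CARD('r) M) (1/2) A"
    if "is_arg_min (g_sym CARD('r) M) (\<lambda>A. A \<in> sym_matrices) A" for A
    using M rM that by (rule KL_exponent_g_sym)
  show "has_KL_exponent UNIV (f_sym M) (1/2) X"
    if "is_arg_min (f_sym M) (\<lambda>X. X \<in> UNIV) X" for X :: "real ^ 'r ^ 'n"
    using M rM that by (rule KL_exponent_f_sym)
qed

end
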